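(* Let $\Phi$ be the first return map to $\pi(X)$ of the geodesic flow on $T^1\mathcal M$, and let $\varphi:\pi(X)\to A$ be the bijection sending $\pi(v)$ (with $v\in X$) to the geodesic $\gamma^v$. (1) $\Phi$ is equivalent to $\rho$: $\Phi$ is well defined on $\pi(X^* )$ with values in $\pi(X)$, and $\varphi\circ\Phi=\rho\circ\varphi$ on $\pi(X^* )$, where $\varphi$ maps $\pi(X^* )$ onto $A^*$ and $\rho:A^*\to A$. (2) For $u\in\pi(X)$, writing $\gamma=\varphi(u)$, one has $|\gamma_\infty|\in E$ if and only if the geodesic on $\mathcal M$ determined by $u$ escapes to a cusp without intersecting $\pi(X)$ for positive time.
   Context: $\Theta\subset\mathrm{SL}(2,\mathbb Z)$ is the theta group: matrices congruent mod $2$ to $\begin{pmatrix}1&0\\0&1\end{pmatrix}$ or $\begin{pmatrix}0&-1\\1&0\end{pmatrix}$; it is generated by $\tau=\begin{pmatrix}1&2\\0&1\end{pmatrix}$ and $\sigma=\begin{pmatrix}0&-1\\1&0\end{pmatrix}$, acting by Möbius maps on the upper half plane $\mathbb H^2$ and on its boundary $\mathbb R\cup\{\infty\}$. $\mathcal M=\Theta\backslash\mathbb H^2$, and $\pi$ denotes both projections $\mathbb H^2\to\mathcal M$ and $T^1\mathbb H^2\to T^1\mathcal M$. Geodesics are oriented; $\gamma_\infty,\gamma_{-\infty}$ are the forward and backward endpoints of a geodesic $\gamma$ in $\mathbb H^2$. For $v\in T^1\mathbb H^2$, $\gamma^v$ is the geodesic determined by $v$ and $p(v)$ its base point. Let $\mathcal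 I_+=(1,\infty)\times[-\sqrt3,-\sqrt3+2)$, $\mathcal I_-=(-\infty,-1)\times(\sqrt3-2,\sqrt3]$, and $X=X_+\cup X_-$ with $X_\pm=\{v\in T^1\mathbb H^2:\mathrm{Re}(p(v))=\pm1,\ (\gamma^v_\infty,\gamma^v_{-\infty})\in\mathcal I_\pm\}$. The cross section is $\pi(X)\subset T^1\mathcal M$; the restriction $\pi|_X$ is a bijection onto $\pi(X)$. Let $A=A_+\cup A_-$, where $A_\pm$ is the set of geodesics $\gamma$ in $\mathbb H^2$ with $(\gamma_\infty,\gamma_{-\infty})\in\mathcal I_\pm$. Let $E=\{\frac{k}{k-1},\frac{2k+1}{2k-1},k: k\ge2 \text{ integer}\}$, $X^*=\{v\in X:|\gamma^v_\infty|\notin E\}$ and $A^*=\{\gamma\in A:|\gamma_\infty|\notin E\}$. For $\gamma\in A$ let $j_\gamma=\mathrm{sgn}(\gamma_\infty)$. The map $\rho:A^*\to A$ is $$\rho(\gamma)=\begin{cases}\sigma\tau^{-j_\gamma k}(\gamma)&|\gamma_\infty|\in(2k,2k+1),\ k\ge1,\\ \sigma\tau^{-j_\gamma k}(\gamma)&|\gamma_\infty|\in(2k-1,2k),\ k\ge2,\\ \tau^{-j_\gamma}(\sigma\tau^{-j_\gamma})^{k-1}(\gamma)&|\gamma_\infty|\in\left(\frac{2k+1}{2k-1},\frac{k}{k-1}\right),\ k\ge2,\\ (\sigma\tau^{-j_\gamma})^k(\gamma)&|\gamma_\infty|\in\left(\frac{k+1}{k},\frac{2k+1}{2k-1}\right),\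 k\ge2.\end{cases}$$ The first return map $\Phi$ sends $u\in\pi(X)$ to $g_t(u)$, where $g_t$ is the geodesic flow on $T^1\mathcal M$ and $t>0$ is the smallest positive time with $g_t(u)\in\pi(X)$; it is defined for those $u$ for which such a $t$ exists. *)

theory Defs
  imports "HOL-Analysis.Analysis" "HOL-Number_Theory.Cong"
begin

section \<open>The theta group and its Moebius action\<close>

type_synonym imat = "int ^ 2 ^ 2"

definition tau :: imat where
  "tau = vector [vector [1, 2], vector [0, 1]]"

definition sigma :: imat where
  "sigma = vector [vector [0, -1], vector [1, 0]]"

definition mat_cong :: "int \<Rightarrow> imat \<Rightarrow> imat \<Rightarrow> bool" where
  "mat_cong m A B \<longleftrightarrow> (\<forall>i j. [A $ i $ j = B $ i $ j] (mod m))"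

definition theta_group :: "imat set" where
  "theta_group = {A. det A = 1 \<and> (mat_cong 2 A (mat 1) \<or> mat_cong 2 A sigma)}"

text \<open>Integer powers with respect to the matrix product; the library's \<open>^\<close> on this type is
  the entrywise power.\<close>
definition mat_powi :: "imat \<Rightarrow> int \<Rightarrow> imat" where
  "mat_powi A n = (((**) (if 0 \<le> n then A else matrix_inv A)) ^^ nat \<bar>n\<bar>) (mat 1)"

definition mob :: "imat \<Rightarrow> complex \<Rightarrow> complex" where
  "mob A z = (of_int (A $ 1 $ 1) * z + of_int (A $ 1 $ 2)) /
             (of_int (A $ 2 $ 1) * z + of_int (A $ 2 $ 2))"

text \<open>The boundary \<open>\<real> \<union> {\<infinity>}\<close> of the upper half plane.\<close>
datatype bdry = Real_pt (bdry_real: real) | Infty_pt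

fun mob_bdry :: "imat \<Rightarrow> bdry \<Rightarrow> bdry" where
  "mob_bdry A (Real_pt x) =
     (if of_int (A $ 2 $ 1) * x + of_int (A $ 2 $ 2) = 0 then Infty_pt
      else Real_pt ((of_int (A $ 1 $ 1) * x + of_int (A $ 1 $ 2)) /
                    (of_int (A $ 2 $ 1) * x + of_int (A $ 2 $ 2))))"
| "mob_bdry A Infty_pt =
     (if A $ 2 $ 1 = 0 then Infty_pt
      else Real_pt (of_int (A $ 1 $ 1) / of_int (A $ 2 $ 1)))"


section \<open>Geodesics of the upper half plane\<close>

definition upper_half_plane :: "complex set" where
  "upper_half_plane = {z. 0 < Im z}"

text \<open>The distance of the Riemannian metric \<open>|dz| / Im z\<close>.\<close>
definition hdist :: "complex \<Rightarrow> complex \<Rightarrow> real" where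
  "hdist z w = arcosh (1 + (cmod (z - w))\<^sup>2 / (2 * Im z * Im w))"

text \<open>Unit speed parametrizations of complete geodesics. In the hyperbolic plane every geodesic
  is globally distance minimizing, so these are the isometric embeddings of the real line.\<close>
definition unit_speed_geodesic :: "(real \<Rightarrow> complex) \<Rightarrow> bool" where
  "unit_speed_geodesic c \<longleftrightarrow>
     range c \<subseteq> upper_half_plane \<and> (\<forall>s t. hdist (c s) (c t) = \<bar>s - t\<bar>)"

text \<open>An oriented geodesic is the class of its unit speed parametrizations, which differ by a
  translation of the parameter.\<close>
type_synonym geodesic = "(real \<Rightarrow> complex) set"

definition geodesic_of :: "(real \<Rightarrow> complex) \<Rightarrow> geodesic" where
  "geodesic_of c = range (\<lambda>s t. c (s + t))"

definition geodesics :: "geodesic set" where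
  "geodesics = geodesic_of ` Collect unit_speed_geodesic"

definition mob_geodesic :: "imat \<Rightarrow> geodesic \<Rightarrow> geodesic" where
  "mob_geodesic A \<gamma> = (\<lambda>c. mob A \<circ> c) ` \<gamma>"

definition tendsto_bdry :: "(real \<Rightarrow> complex) \<Rightarrow> bdry \<Rightarrow> real filter \<Rightarrow> bool" where
  "tendsto_bdry c b F = (case b of Real_pt x \<Rightarrow> (c \<longlongrightarrow> complex_of_real x) F
                                 | Infty_pt \<Rightarrow> filterlim c at_infinity F)"

definition fwd_end :: "geodesic \<Rightarrow> bdry" where
  "fwd_end \<gamma> = (THE b. \<forall>c\<in>\<gamma>. tendsto_bdry c b at_top)"

definition bwd_end :: "geodesic \<Rightarrow> bdry" where
  "bwd_end \<gamma> = (THE b. \<forall>c\<in>\<gamma>. tendsto_bdry c b at_bot)"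

text \<open>The forward endpoint as a real number; meaningful only when it is not \<open>\<infinity>\<close>.\<close>
abbreviation fwd_real :: "geodesic \<Rightarrow> real" where
  "fwd_real \<gamma> \<equiv> bdry_real (fwd_end \<gamma>)"


section \<open>Unit tangent bundle and geodesic flow\<close>

text \<open>Tangent vectors are pairs of a base point and a direction; a direction \<open>w\<close> at \<open>z\<close> has
  hyperbolic length \<open>|w| / Im z\<close>.\<close>
type_synonym tvec = "complex \<times> complex"

definition T1H :: "tvec set" where
  "T1H = {(z, w). z \<in> upper_half_plane \<and> cmod w / Im z = 1}"

text \<open>The action on tangent vectors by the differential.\<close>
definition mob_T :: "imat \<Rightarrow> tvec \<Rightarrow> tvec" where
  "mob_T A = (\<lambda>(z, w). (mob A z, deriv (mob A) z * w))"

definition curve_of :: "tvec \<Rightarrow> real \<Rightarrow> complex" where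
  "curve_of v = (THE c. unit_speed_geodesic c \<and> c 0 = fst v \<and>
                        (c has_vector_derivative snd v) (at 0))"

definition geodesic_of_vec :: "tvec \<Rightarrow> geodesic" where
  "geodesic_of_vec v = geodesic_of (curve_of v)"

definition flow_H :: "real \<Rightarrow> tvec \<Rightarrow> tvec" where
  "flow_H t v = (curve_of v t, vector_derivative (curve_of v) (at t))"


section \<open>The quotient by the theta group\<close>

text \<open>Points of the quotient surface and of its unit tangent bundle are orbits of the theta group
  on the upper half plane and on its unit tangent bundle.\<close>
definition proj_H :: "complex \<Rightarrow> complex set" where
  "proj_H z = (\<lambda>A. mob A z) ` theta_group"

definition proj_T :: "tvec \<Rightarrow> tvec set" where
  "proj_T v = (\<lambda>A. mob_T A v) ` theta_group"

text \<open>The flow commutes with the action of the theta group, so it maps orbits onto orbits.\<close>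
definition flow_M :: "real \<Rightarrow> tvec set \<Rightarrow> tvec set" where
  "flow_M t u = flow_H t ` u"

text \<open>For an orbit \<open>u\<close> of tangent vectors, \<open>fst ` u\<close> is the orbit of base points.\<close>
definition base_M :: "tvec set \<Rightarrow> complex set" where
  "base_M u = fst ` u"

definition is_cusp :: "bdry \<Rightarrow> bool" where
  "is_cusp b \<longleftrightarrow> (\<exists>A\<in>theta_group. \<bar>trace A\<bar> = 2 \<and> A \<noteq> mat 1 \<and> A \<noteq> - mat 1 \<and> mob_bdry A b = b)"

text \<open>Horoballs centred at a boundary point; at a real point \<open>x\<close> the condition
  \<open>Im z > h |z - x|\<^sup>2\<close> describes the open disc of diameter \<open>1/h\<close> tangent to the real axis at \<open>x\<close>.
  They shrink to the boundary point as \<open>h\<close> grows.\<close>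
definition horoball :: "bdry \<Rightarrow> real \<Rightarrow> complex set" where
  "horoball b h = (case b of Real_pt x \<Rightarrow> {z. h * (cmod (z - complex_of_real x))\<^sup>2 < Im z}
                           | Infty_pt \<Rightarrow> {z. h < Im z})"

text \<open>The images of the horoballs at a cusp form a basis of neighbourhoods of the corresponding
  puncture of the quotient surface.\<close>
definition escapes_to_cusp :: "tvec set \<Rightarrow> bool" where
  "escapes_to_cusp u \<longleftrightarrow>
     (\<exists>b. is_cusp b \<and>
        (\<forall>h>0. \<forall>\<^sub>F t in at_top. base_M (flow_M t u) \<in> proj_H ` horoball b h))"


section \<open>The cross section\<close>

definition I_plus :: "(real \<times> real) set" where
  "I_plus = {1<..} \<times> {- sqrt 3..<- sqrt 3 + 2}"

definition I_minus :: "(real \<times> real) set" where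
  "I_minus = {..<-1} \<times> {sqrt 3 - 2<..sqrt 3}"

definition ends_in :: "geodesic \<Rightarrow> (real \<times> real) set \<Rightarrow> bool" where
  "ends_in \<gamma> I \<longleftrightarrow> (fwd_end \<gamma>, bwd_end \<gamma>) \<in> map_prod Real_pt Real_pt ` I"

definition X_plus :: "tvec set" where
  "X_plus = {v \<in> T1H. Re (fst v) = 1 \<and> ends_in (geodesic_of_vec v) I_plus}"

definition X_minus :: "tvec set" where
  "X_minus = {v \<in> T1H. Re (fst v) = -1 \<and> ends_in (geodesic_of_vec v) I_minus}"

definition X_set :: "tvec set" where
  "X_set = X_plus \<union> X_minus"

definition A_plus :: "geodesic set" where
  "A_plus = {\<gamma> \<in> geodesics. ends_in \<gamma> I_plus}"

definition A_minus :: "geodesic set" where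
  "A_minus = {\<gamma> \<in> geodesics. ends_in \<gamma> I_minus}"

definition A_set :: "geodesic set" where
  "A_set = A_plus \<union> A_minus"

definition E_set :: "real set" where
  "E_set = (\<Union>k\<in>{2::int..}. {of_int k / (of_int k - 1),
                               (2 * of_int k + 1) / (2 * of_int k - 1), of_int k})"

definition X_star :: "tvec set" where
  "X_star = {v \<in> X_set. \<bar>fwd_real (geodesic_of_vec v)\<bar> \<notin> E_set}"

definition A_star :: "geodesic set" where
  "A_star = {\<gamma> \<in> A_set. \<bar>fwd_real \<gamma>\<bar> \<notin> E_set}"

definition j_sgn :: "geodesic \<Rightarrow> int" where
  "j_sgn \<gamma> = \<lfloor>sgn (fwd_real \<gamma>)\<rfloor>"

text \<open>The graph of the map on \<open>A_star\<close> with its four cases; the intervals involved are pairwise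
  disjoint.\<close>
definition rho_rel :: "geodesic \<Rightarrow> geodesic \<Rightarrow> bool" where
  "rho_rel \<gamma> \<gamma>' \<longleftrightarrow>
     (let y = \<bar>fwd_real \<gamma>\<bar>; j = j_sgn \<gamma>; st = sigma ** mat_powi tau (- j) in
      \<exists>k::int.
        (1 \<le> k \<and> y \<in> {2 * of_int k<..<2 * of_int k + 1} \<and>
           \<gamma>' = mob_geodesic (sigma ** mat_powi tau (- j * k)) \<gamma>) \<or>
        (2 \<le> k \<and> y \<in> {2 * of_int k - 1<..<2 * of_int k} \<and>
           \<gamma>' = mob_geodesic (sigma ** mat_powi tau (- j * k)) \<gamma>) \<or>
        (2 \<le> k \<and> y \<in> {(2 * of_int k + 1) / (2 * of_int k - 1)<..<of_int k / (of_int k - 1)} \<and>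
           \<gamma>' = mob_geodesic (mat_powi tau (- j) ** mat_powi st (k - 1)) \<gamma>) \<or>
        (2 \<le> k \<and> y \<in> {(of_int k + 1) / of_int k<..<(2 * of_int k + 1) / (2 * of_int k - 1)} \<and>
           \<gamma>' = mob_geodesic (mat_powi st k) \<gamma>))"

definition rho :: "geodesic \<Rightarrow> geodesic" where
  "rho \<gamma> = (THE \<gamma>'. rho_rel \<gamma> \<gamma>')"

definition phi :: "tvec set \<Rightarrow> geodesic" where
  "phi u = geodesic_of_vec (the_inv_into X_set proj_T u)"

definition is_first_return_time :: "tvec set \<Rightarrow> real \<Rightarrow> bool" where
  "is_first_return_time u t \<longleftrightarrow> 0 < t \<and> flow_M t u \<in> proj_T ` X_set \<and>
     (\<forall>s. 0 < s \<and> flow_M s u \<in> proj_T ` X_set \<longrightarrow> t \<le> s)"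

definition first_return :: "tvec set \<rightharpoonup> tvec set" where
  "first_return u =
     (if u \<in> proj_T ` X_set \<and> (\<exists>t. is_first_return_time u t)
      then Some (flow_M (THE t. is_first_return_time u t) u) else None)"

end

theory Submission
  imports Defs
begin

text \<open>A real matrix \<open>M\<close> of positive determinant sends the upward unit vector at \<open>\<i>\<close> to a unit tangent
  vector; in this picture the geodesic flow multiplies \<open>M\<close> on the right by a diagonal matrix, the theta
  group multiplies on the left, and the endpoints are the ratios of the columns of \<open>M\<close>.
  The images of the lines \<open>Re z = \<plusminus>1\<close> under the theta group are Farey edges, and they tile the upper half
  plane by the translates of the ideal quadrilateral with vertices \<open>-1, 0, 1, \<infinity>\<close>. A geodesic entering
  the tile with vertices \<open>1, 2, 3, \<infinity>\<close> through \<open>Re z = 1\<close> leaves it through one of the other three sides,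
  or runs into the cusp \<open>2\<close> or \<open>3\<close>. Bringing the exit side back to \<open>Re z = \<plusminus>1\<close> acts on the pair of
  endpoints \<open>(x, y)\<close> by \<open>(x - 2, y - 2)\<close> if \<open>x > 3\<close>, by \<open>(1 / (2 - x), 1 / (2 - y))\<close> otherwise. The new
  vector lies in the cross section exactly when the new backward endpoint lies in the prescribed
  interval of length \<open>2\<close>, so the first return is found by induction on the number of tiles crossed, and
  the exceptional set \<open>E\<close> consists of the \<open>x\<close> whose orbit hits \<open>2\<close> or \<open>3\<close> before the return.\<close>

section \<open>Unit speed geodesics\<close>

text \<open>Why the interval of backward endpoints is [-sqrt 3, 2 - sqrt 3): \<open>y - 2\<close>
  carries its upper end to its lower end, and \<open>1 / (2 - y)\<close> carries the lower end to
  the upper one, since (2 - sqrt 3)(2 + sqrt 3) = 1. So a translation out of the interval lands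
  below it and a rotation with x < 2 lands above it. Further translations stay below and further
  rotations with x < 2 stay above; the first different move re-enters, and a rotation with 2 < x < 3
  enters from anywhere. A return is therefore a possibly empty run of equal moves followed by one
  different move, and these are the four cases of \<open>rho\<close>. The length of a run is read
  off x: translations lower x by 2, and in the coordinate s = 2 / (x - 1) the rotation with x < 2 is
  s -> s - 2. The obstacle is that a return is a statement about orbits: no theta image of the open
  segment inside a tile may touch the lines \<open>Re z = 1\<close> and \<open>Re z = -1\<close>,
  and distinct crossings of these lines must not be identified. Both are integer inequalities for
  Farey edges.\<close>

definition real_mob :: "real \<Rightarrow> real \<Rightarrow> real \<Rightarrow> real \<Rightarrow> complex \<Rightarrow> complex" where
  "real_mob a b c d z = (of_real a * z + of_real b) / (of_real c * z + of_real d)"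

lemma real_mob_denom_nz:
  assumes "a * d - b * c > 0" "Im z > 0"
  shows "of_real c * z + of_real d \<noteq> (0::complex)"
  using assms by (auto simp: complex_eq_iff)

lemma Im_real_mob: "Im (real_mob a b c d z) = (a * d - b * c) * Im z / (cmod (of_real c * z + of_real d))\<^sup>2"
  unfolding real_mob_def complex_div_cnj[of _ "of_real c * z + of_real d"]
  by (simp add: algebra_simps flip: of_real_power)

lemma Re_real_mob: "Re (real_mob a b c d z) = (a * c * (cmod z)\<^sup>2 + (a * d + b * c) * Re z + b * d)
    / (cmod (of_real c * z + of_real d))\<^sup>2"
  unfolding real_mob_def complex_div_cnj[of _ "of_real c * z + of_real d"] cmod_power2[of z]
  by (simp add: algebra_simps power2_eq_square flip: of_real_power of_real_mult)

lemma Im_real_mob_pos: "a * d - b * c > 0 \<Longrightarrow> Im z > 0 \<Longrightarrow> Im (real_mob a b c d z) > 0"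
  using real_mob_denom_nz[of a d b c z] by (simp add: Im_real_mob)

lemma real_mob_compose:
  assumes "a' * d' - b' * c' > 0" "Im z > 0"
  shows "real_mob a b c d (real_mob a' b' c' d' z) =
    real_mob (a*a' + b*c') (a*b' + b*d') (c*a' + d*c') (c*b' + d*d') z"
proof -
  have nz: "of_real c' * z + of_real d' \<noteq> (0::complex)"
    using real_mob_denom_nz assms by blast
  let ?D = "of_real c' * z + of_real d'"
  have "real_mob a b c d (real_mob a' b' c' d' z) =
     ((of_real a * (of_real a' * z + of_real b') + of_real b * ?D) / ?D)
     / ((of_real c * (of_real a' * z + of_real b') + of_real d * ?D) / ?D)"
    unfolding real_mob_def using nz by (intro arg_cong2[of _ _ _ _ "(/)"]) (simp_all add: add_frac_eq divide_simps)
  also have "\<dots> = (of_real a * (of_real a' * z + of_real b') + of_real b * ?D)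
     / (of_real c * (of_real a' * z + of_real b') + of_real d * ?D)"
    using nz by simp
  finally show ?thesis
    by (simp add: real_mob_def algebra_simps)
qed

lemma real_mob_scale: "s \<noteq> 0 \<Longrightarrow> real_mob (s*a) (s*b) (s*c) (s*d) z = real_mob a b c d z"
proof -
  assume "s \<noteq> 0"
  have "real_mob (s*a) (s*b) (s*c) (s*d) z = (of_real s * (of_real a * z + of_real b)) / (of_real s * (of_real c * z + of_real d))"
    by (simp add: real_mob_def algebra_simps)
  also have "\<dots> = real_mob a b c d z" using \<open>s \<noteq> 0\<close> by (simp add: real_mob_def)
  finally show ?thesis .
qed

lemma real_mob_inverse:
  assumes "a * d - b * c > 0" "Im z > 0"
  shows "real_mob a b c d (real_mob d (-b) (-c) a z) = z"
proof -
  have "real_mob a b c d (real_mob d (-b) (-c) a z) = real_mob ((a*d-b*c)*1) ((a*d-b*c)*0) ((a*d-b*c)*0) ((a*d-b*c)*1) z"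
    by (subst real_mob_compose) (use assms in \<open>auto simp: algebra_simps\<close>)
  also have "\<dots> = real_mob 1 0 0 1 z"
    by (rule real_mob_scale) (use assms in auto)
  finally show ?thesis by (simp add: real_mob_def)
qed

lemma real_mob_diff:
  assumes "a * d - b * c > 0" "Im z > 0" "Im w > 0"
  shows "real_mob a b c d z - real_mob a b c d w = of_real (a*d-b*c) * (z - w) /
     ((of_real c * z + of_real d) * (of_real c * w + of_real d))"
  using real_mob_denom_nz[OF assms(1,2)] real_mob_denom_nz[OF assms(1,3)]
  by (simp add: real_mob_def divide_simps algebra_simps)

lemma hdist_real_mob:
  assumes "a * d - b * c > 0" "Im z > 0" "Im w > 0"
  shows "hdist (real_mob a b c d z) (real_mob a b c d w) = hdist z w"
proof -
  let ?Z = "cmod (of_real c * z + of_real d)" and ?W = "cmod (of_real c * w + of_real d)"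
  have nz: "?Z > 0" "?W > 0"
    using real_mob_denom_nz[OF assms(1,2)] real_mob_denom_nz[OF assms(1,3)] by auto
  have "(cmod (real_mob a b c d z - real_mob a b c d w))\<^sup>2 = ((a*d-b*c) * cmod (z - w) / (?Z * ?W))\<^sup>2"
    unfolding real_mob_diff[OF assms] using assms(1)
    by (simp add: norm_mult norm_divide del: of_real_diff of_real_mult)
  note * = this
  have "(cmod (real_mob a b c d z - real_mob a b c d w))\<^sup>2 / (2 * Im (real_mob a b c d z) * Im (real_mob a b c d w))
      = (cmod (z - w))\<^sup>2 / (2 * Im z * Im w)"
    unfolding * Im_real_mob using assms nz by (simp add: divide_simps power2_eq_square)
  thus ?thesis by (simp add: hdist_def)
qed

lemma hdist_eq_iff:
  assumes "Im z > 0" "Im w > 0" 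
  shows "hdist z w = \<bar>r\<bar> \<longleftrightarrow> (cmod (z - w))\<^sup>2 = 2 * Im z * Im w * (cosh r - 1)"
proof -
  let ?q = "(cmod (z - w))\<^sup>2 / (2 * Im z * Im w)"
  have q: "?q \<ge> 0" using assms by simp
  have "hdist z w = \<bar>r\<bar> \<longleftrightarrow> 1 + ?q = cosh r"
  proof
    assume "hdist z w = \<bar>r\<bar>"
    hence "cosh (hdist z w) = cosh r" by simp
    thus "1 + ?q = cosh r" using q by (simp add: hdist_def cosh_arcosh_real)
  next
    assume "1 + ?q = cosh r"
    hence "hdist z w = arcosh (cosh \<bar>r\<bar>)" by (simp add: hdist_def)
    thus "hdist z w = \<bar>r\<bar>" by (subst (asm) arcosh_cosh_real) auto
  qed
  also have "\<dots> \<longleftrightarrow> (cmod (z - w))\<^sup>2 = 2 * Im z * Im w * (cosh r - 1)"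
    using assms by (auto simp: field_simps)
  finally show ?thesis .
qed

definition geo :: "real \<Rightarrow> real \<Rightarrow> real \<Rightarrow> real \<Rightarrow> real \<Rightarrow> complex" where
  "geo a b c d t = real_mob a b c d (of_real (exp t) * \<i>)"

lemma hdist_imag: "hdist (of_real (exp s) * \<i>) (of_real (exp t) * \<i>) = \<bar>s - t\<bar>"
proof (subst hdist_eq_iff)
  have *: "exp s = exp (s - t) * exp t" by (simp flip: exp_add)
  have "cmod (of_real (exp s) * \<i> - of_real (exp t) * \<i>) = \<bar>exp s - exp t\<bar>"
    by (simp add: norm_mult flip: left_diff_distrib of_real_diff)
  hence "(cmod (of_real (exp s) * \<i> - of_real (exp t) * \<i>))\<^sup>2 = (exp s - exp t)\<^sup>2" by simp
  also have "\<dots> = 2 * exp s * exp t * (cosh (s - t) - 1)"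
    unfolding * cosh_def exp_minus by (simp add: field_simps power2_eq_square)
  finally show "(cmod (of_real (exp s) * \<i> - of_real (exp t) * \<i>))\<^sup>2 =
    2 * Im (of_real (exp s) * \<i>) * Im (of_real (exp t) * \<i>) * (cosh (s - t) - 1)" by simp
qed auto

lemma unit_speed_geo:
  assumes "a * d - b * c > 0"
  shows "unit_speed_geodesic (geo a b c d)"
  unfolding unit_speed_geodesic_def
proof (intro conjI allI)
  show "range (geo a b c d) \<subseteq> upper_half_plane"
    using assms by (auto simp: geo_def upper_half_plane_def intro!: Im_real_mob_pos)
  show "hdist (geo a b c d s) (geo a b c d t) = \<bar>s - t\<bar>" for s t
    unfolding geo_def by (subst hdist_real_mob[OF assms]) (auto simp: hdist_imag)
qed

text \<open>The matrices with rows (u, v) and (-v, u) are the rotations about i, up to scaling; some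
  rotation turns the given point onto the imaginary axis.\<close>

lemma ex_rotation_to_imaginary:
  assumes "Im z > 0" "z \<noteq> \<i>"
  shows "\<exists>u v m. u\<^sup>2 + v\<^sup>2 > 0 \<and> m > 0 \<and> real_mob u v (-v) u (of_real m * \<i>) = z"
proof -
  define x N where "x = Re z" and "N = (cmod z)\<^sup>2"
  define \<zeta> where "\<zeta> = Complex ((N - 1) / 2) (- x)"
  define u v where "u = Re (csqrt \<zeta>)" and "v = Im (csqrt \<zeta>)"
  have "(csqrt \<zeta>)\<^sup>2 = \<zeta>" by simp
  hence "Re ((csqrt \<zeta>)\<^sup>2) = Re \<zeta>" "Im ((csqrt \<zeta>)\<^sup>2) = Im \<zeta>" by simp_all
  hence uv: "u\<^sup>2 - v\<^sup>2 = (N - 1) / 2" "2 * u * v = - x"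
    unfolding Re_power2 Im_power2 u_def[symmetric] v_def[symmetric] by (simp_all add: \<zeta>_def)
  have "u\<^sup>2 + v\<^sup>2 \<noteq> 0"
  proof
    assume "u\<^sup>2 + v\<^sup>2 = 0"
    hence "u = 0" "v = 0" by (auto simp: sum_power2_eq_zero_iff)
    hence "x = 0" "N = 1" using uv by auto
    hence "Im z = 1" using assms(1) by (simp add: x_def N_def cmod_power2 power2_eq_1_iff)
    thus False using assms(2) \<open>x = 0\<close> by (auto simp: complex_eq_iff x_def)
  qed
  hence pos: "u\<^sup>2 + v\<^sup>2 > 0" by (simp add: sum_power2_gt_zero_iff)
  hence pos': "u * u - v * - v > 0" "u * u - (-v) * v > 0" by (simp_all add: power2_eq_square)
  define s where "s = real_mob u (-v) v u z"
  have "Re s = 0"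
  proof -
    have "u * v * N + (u * u + (-v) * v) * x + (-v) * u = u * v * (N-1) + (u\<^sup>2 - v\<^sup>2) * x"
      by (simp add: algebra_simps power2_eq_square)
    also have "\<dots> = (2*u * v) * ((N-1)/2) + (u\<^sup>2 - v\<^sup>2) * x" by simp
    also have "\<dots> = 0" unfolding uv by simp
    finally show ?thesis unfolding s_def Re_real_mob by (simp add: N_def x_def)
  qed
  moreover have "Im s > 0" unfolding s_def by (rule Im_real_mob_pos) (use pos' assms in auto)
  moreover have "real_mob u v (-v) u s = z"
    using real_mob_inverse[of u u v "-v" z] pos' assms(1) by (simp add: s_def)
  moreover have "s = of_real (Im s) * \<i>" using \<open>Re s = 0\<close> by (simp add: complex_eq_iff)
  ultimately show ?thesis using pos by metis
qed

text \<open>The distances |t| and |t - 1| to the two known points pin down \<open>c t\<close>.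
  Subtracting the two distance equations removes its squared modulus and leaves a linear equation
  for its height, solved by exp (e t); the squared modulus is then the square of the height, so the
  real part is zero.\<close>

lemma geodesic_through_two_imaginary_points:
  assumes c: "unit_speed_geodesic c" and c0: "c 0 = \<i>" and c1: "c 1 = of_real m * \<i>" and m: "m > 0"
  shows "(\<forall>t. c t = of_real (exp t) * \<i>) \<or> (\<forall>t. c t = of_real (exp (-t)) * \<i>)"
proof -
  have Im: "Im (c t) > 0" for t
    using c by (auto simp: unit_speed_geodesic_def upper_half_plane_def)
  have d: "hdist (c s) (c t) = \<bar>s - t\<bar>" for s t
    using c by (auto simp: unit_speed_geodesic_def)
  have mm: "m = exp (ln m)" using m by simp
  have "hdist (of_real (exp 0) * \<i>) (of_real (exp (ln m)) * \<i>) = 1"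
    using d[of 0 1] c0 c1 m by simp
  hence "\<bar>ln m\<bar> = 1" by (subst (asm) hdist_imag) auto
  then obtain e where e: "e = 1 \<or> e = -1" "m = exp e" using mm by (cases "ln m \<ge> 0") auto
  have main: "c t = of_real (exp (e * t)) * \<i>" for t
  proof -
    define y N where "y = Im (c t)" and "N = (cmod (c t))\<^sup>2"
    have y: "y > 0" using Im by (simp add: y_def)
    have N: "N = (Re (c t))\<^sup>2 + y\<^sup>2" by (simp add: N_def y_def cmod_power2)
    have "(cmod (c t - c 0))\<^sup>2 = 2 * y * (cosh t - 1)"
      using d[of t 0] hdist_eq_iff[OF Im Im, of t 0 t] by (simp add: c0 y_def)
    moreover have "(cmod (c t - c 0))\<^sup>2 = N + 1 - 2 * y"
      unfolding cmod_power2 c0 N y_def by (simp add: power2_eq_square algebra_simps)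
    ultimately have 1: "N + 1 = 2 * y * cosh t" by (simp add: algebra_simps)
    have "(cmod (c t - c 1))\<^sup>2 = 2 * y * m * (cosh (t - 1) - 1)"
      using d[of t 1] hdist_eq_iff[OF Im Im, of t 1 "t-1"] by (simp add: c1 y_def)
    moreover have "(cmod (c t - c 1))\<^sup>2 = N + m\<^sup>2 - 2 * m * y"
      unfolding cmod_power2 c1 N y_def by (simp add: power2_eq_square algebra_simps)
    ultimately have 2: "N + m\<^sup>2 = 2 * y * m * cosh (t - 1)" by (simp add: algebra_simps)
    define T where "T = exp (e * t)"
    have T: "T > 0" by (simp add: T_def)
    have ct: "cosh t = (T + 1/T) / 2" using e(1) 
      by (auto simp: cosh_def T_def exp_minus field_simps)
    have ct1: "cosh (t - 1) = (T / m + m / T) / 2" using e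
      by (auto simp: cosh_def T_def exp_minus exp_diff exp_add divide_simps algebra_simps)
    have m1: "m\<^sup>2 \<noteq> 1"
    proof
      assume "m\<^sup>2 = 1"
      hence "m = 1" using m by (simp add: power2_eq_1_iff)
      thus False using e by auto
    qed
    have "m\<^sup>2 - 1 = y * (m * (T/m + m/T) - (T + 1/T))"
    proof -
      have "2 * y * m * ((T / m + m / T) / 2) - 2 * y * ((T + 1/T) / 2) = y * (m * (T/m + m/T) - (T + 1/T))"
        using m T by (simp add: field_simps)
      thus ?thesis using 1 2 unfolding ct ct1 by linarith
    qed
    also have "y * (m * (T/m + m/T) - (T + 1/T)) = y * ((m\<^sup>2 - 1) / T)" using m T by (simp add: field_simps power2_eq_square)
    finally have "(m\<^sup>2 - 1) * T = (m\<^sup>2 - 1) * y" using T by (simp add: field_simps)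
    hence "y = T" using m1 by simp
    have "N = 2 * T * ((T + 1/T)/2) - 1" using 1 unfolding ct \<open>y = T\<close> by simp
    also have "\<dots> = T\<^sup>2" using T by (simp add: field_simps power2_eq_square)
    finally have "Re (c t) = 0" using N \<open>y = T\<close> by simp
    thus ?thesis using \<open>y = T\<close> by (simp add: complex_eq_iff y_def T_def)
  qed
  show ?thesis using e(1) main by auto
qed

lemma unit_speed_geodesic_real_mob:
  assumes "a * d - b * c > 0" "unit_speed_geodesic g"
  shows "unit_speed_geodesic (\<lambda>t. real_mob a b c d (g t))"
  unfolding unit_speed_geodesic_def
proof (intro conjI allI)
  have Im: "Im (g t) > 0" for t
    using assms by (auto simp: unit_speed_geodesic_def upper_half_plane_def)
  show "range (\<lambda>t. real_mob a b c d (g t)) \<subseteq> upper_half_plane"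
    using Im Im_real_mob_pos[OF assms(1)] by (auto simp: upper_half_plane_def)
  show "hdist (real_mob a b c d (g s)) (real_mob a b c d (g t)) = \<bar>s - t\<bar>" for s t
    using hdist_real_mob[OF assms(1) Im Im] assms(2) by (simp add: unit_speed_geodesic_def)
qed

text \<open>An affine map brings \<open>g 0\<close> to i and a rotation about i brings
  \<open>g 1\<close> to the imaginary axis. Only the axis traversed upwards or downwards is then
  possible.\<close>

lemma unit_speed_geodesic_iff:
  "unit_speed_geodesic g \<longleftrightarrow> (\<exists>a b c d. a * d - b * c > 0 \<and> g = geo a b c d)"
proof
  assume g: "unit_speed_geodesic g"
  have Im: "Im (g t) > 0" for t
    using g by (auto simp: unit_speed_geodesic_def upper_half_plane_def)
  define X Y where "X = Re (g 0)" and "Y = Im (g 0)"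
  have Y: "Y > 0" using Im by (simp add: Y_def)
  hence g0: "real_mob 1 (-X) 0 Y (g 0) = \<i>" by (simp add: real_mob_def X_def Y_def complex_eq_iff)
  define h where "h t = real_mob 1 (-X) 0 Y (g t)" for t
  have h: "unit_speed_geodesic h" unfolding h_def
    by (rule unit_speed_geodesic_real_mob) (use Y g in auto)
  have Imh: "Im (h t) > 0" for t
    using h by (auto simp: unit_speed_geodesic_def upper_half_plane_def)
  have h0: "h 0 = \<i>" by (simp add: h_def g0)
  have "h 1 \<noteq> \<i>"
  proof
    assume "h 1 = \<i>"
    hence "hdist (h 0) (h 1) = 0" using h0 by (simp add: hdist_def)
    thus False using h by (simp add: unit_speed_geodesic_def)
  qed
  then obtain u v m where uvm: "u\<^sup>2 + v\<^sup>2 > 0" "m > 0" "real_mob u v (-v) u (of_real m * \<i>) = h 1"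
    using ex_rotation_to_imaginary[OF Imh] by blast
  have det: "u * u - v * - v > 0" "u * u - - v * v > 0" 
    using uvm(1) by (simp_all add: power2_eq_square)
  define k where "k t = real_mob u (-v) v u (h t)" for t
  have hk: "h t = real_mob u v (-v) u (k t)" for t
    using real_mob_inverse[OF det(1) Imh] by (simp add: k_def)
  have "unit_speed_geodesic k" unfolding k_def
    by (rule unit_speed_geodesic_real_mob) (use det h in auto)
  moreover have "k 0 = \<i>"
  proof -
    have nz: "complex_of_real v * \<i> + of_real u \<noteq> 0"
      using uvm(1) by (auto simp: complex_eq_iff)
    show ?thesis unfolding k_def h0 real_mob_def using nz by (simp add: divide_simps algebra_simps)
  qed
  moreover have "k 1 = of_real m * \<i>"
    using real_mob_inverse[of u u "-v" v "of_real m * \<i>"] det uvm by (simp add: k_def)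
  ultimately have "(\<forall>t. k t = of_real (exp t) * \<i>) \<or> (\<forall>t. k t = of_real (exp (-t)) * \<i>)"
    using geodesic_through_two_imaginary_points uvm by blast
  moreover have gh: "g t = real_mob Y X 0 1 (h t)" for t
    using real_mob_inverse[of Y 1 X 0 "g t"] Y Im by (simp add: h_def)
  have gk: "g t = real_mob (Y*u - X * v) (Y * v+X*u) (-v) u (k t)" if "Im (k t) > 0" for t
    unfolding gh hk using that det by (simp add: real_mob_compose)
  ultimately show "\<exists>a b c d. a * d - b * c > 0 \<and> g = geo a b c d"
  proof (elim disjE)
    assume k: "\<forall>t. k t = of_real (exp t) * \<i>"
    have "(Y*u - X * v) * u - (Y * v+X*u) * (-v) = Y * (u\<^sup>2 + v\<^sup>2)"
      by (simp add: algebra_simps power2_eq_square)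
    hence "(Y*u - X * v) * u - (Y * v+X*u) * (-v) > 0" using Y uvm(1) by simp
    moreover have "g = geo (Y*u - X * v) (Y * v+X*u) (-v) u"
      using gk k by (auto simp: geo_def fun_eq_iff)
    ultimately show ?thesis by blast
  next
    assume k: "\<forall>t. k t = of_real (exp (-t)) * \<i>"
    have "(Y * v+X*u) * v - (X * v - Y*u) * u = Y * (u\<^sup>2 + v\<^sup>2)"
      by (simp add: algebra_simps power2_eq_square)
    hence det': "(Y * v+X*u) * v - (X * v - Y*u) * u > 0" using Y uvm(1) by simp
    \<comment> \<open>The downward axis is the upward one followed by -1/z, so the reversal is
      absorbed into the matrix.\<close>
    have [simp]: "k t = real_mob 0 (-1) 1 0 (of_real (exp t) * \<i>)" for t
      using k by (simp add: real_mob_def exp_minus field_simps)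
    hence "g t = real_mob (Y*u - X * v) (Y * v+X*u) (-v) u (real_mob 0 (-1) 1 0 (of_real (exp t) * \<i>))" for t
      using gk[of t] Im_real_mob_pos[of 0 0 "-1" 1 "of_real (exp t) * \<i>"] by simp
    hence "g t = geo (Y * v+X*u) (X * v - Y*u) u v t" for t
      by (simp add: geo_def real_mob_compose)
    hence "g = geo (Y * v+X*u) (X * v - Y*u) u v" by blast
    thus ?thesis using det' by (metis mult.commute)
  qed
qed (auto simp: unit_speed_geo)


section \<open>Unit tangent vectors as matrices\<close>

lemma geo_0: "geo a b c d 0 = real_mob a b c d \<i>"
  by (simp add: geo_def)

lemma geo_add: "geo a b c d (s + t) = geo (a * exp s) b (c * exp s) d t"
  by (simp add: geo_def real_mob_def exp_add mult_ac)

definition tangent :: "real \<Rightarrow> real \<Rightarrow> real \<Rightarrow> real \<Rightarrow> tvec" where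
  "tangent a b c d = (real_mob a b c d \<i>, of_real (a * d - b * c) * \<i> / (of_real c * \<i> + of_real d)\<^sup>2)"

lemma real_mob_has_field_derivative:
  assumes "of_real c * z + of_real d \<noteq> (0::complex)"
  shows "(real_mob a b c d has_field_derivative of_real (a * d - b * c) / (of_real c * z + of_real d)\<^sup>2) (at z)"
  unfolding real_mob_def[abs_def]
  by (rule derivative_eq_intros | use assms in \<open>simp add: power2_eq_square algebra_simps\<close>)+

lemma geo_has_vector_derivative:
  assumes "a * d - b * c > 0"
  shows "(geo a b c d has_vector_derivative snd (tangent (a * exp t) b (c * exp t) d)) (at t)"
proof -
  have "((\<lambda>t. complex_of_real (exp t) * \<i>) has_vector_derivative of_real (exp t) * \<i>) (at t)"
    by (auto intro!: derivative_eq_intros simp: has_vector_derivative_def scaleR_conv_of_real)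
  moreover have "(real_mob a b c d has_field_derivative of_real (a * d - b * c) /
      (of_real c * (of_real (exp t) * \<i>) + of_real d)\<^sup>2) (at (of_real (exp t) * \<i>))"
    by (rule real_mob_has_field_derivative) (rule real_mob_denom_nz, use assms in auto)
  ultimately have "((real_mob a b c d \<circ> (\<lambda>t. of_real (exp t) * \<i>)) has_vector_derivative
     of_real (exp t) * \<i> * (of_real (a * d - b * c) /
      (of_real c * (of_real (exp t) * \<i>) + of_real d)\<^sup>2)) (at t)"
    by (rule field_vector_diff_chain_at)
  thus ?thesis
    by (simp add: o_def geo_def[abs_def] tangent_def algebra_simps)
qed

lemma det_scale_pos: "a * d - b * c > 0 \<Longrightarrow> (a * exp t) * d - b * (c * exp t) > (0::real)"
proof -
  assume "a * d - b * c > 0"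
  hence "exp t * (a * d - b * c) > 0" by simp
  thus ?thesis by (simp add: algebra_simps)
qed

lemma tangent_in_T1H:
  assumes "a * d - b * c > 0"
  shows "tangent a b c d \<in> T1H"
proof -
  have nz: "of_real c * \<i> + of_real d \<noteq> (0::complex)"
    by (rule real_mob_denom_nz[OF assms]) auto
  have "Im (real_mob a b c d \<i>) > 0" by (rule Im_real_mob_pos[OF assms]) auto
  thus ?thesis using assms nz
    by (simp add: T1H_def upper_half_plane_def tangent_def Im_real_mob norm_divide norm_mult norm_power
          del: of_real_diff of_real_mult)
qed

lemma ex_tangent:
  assumes "v \<in> T1H"
  obtains a b c d where "a * d - b * c > 0" "v = tangent a b c d"
proof -
  obtain z w where v: "v = (z, w)" by (cases v)
  define X Y where "X = Re z" and "Y = Im z"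
  have Y: "Y > 0" and w: "cmod w = Y"
    using assms by (auto simp: v T1H_def upper_half_plane_def Y_def)
  \<comment> \<open>Iwasawa decomposition: a rotation with bottom row (c, d), c^2 + d^2 = 1,
    followed by z -> Y z + X. The direction requires Y i / q^2 = w for q = c i + d, which makes q a
    square root.\<close>
  define q where "q = csqrt (of_real Y * \<i> / w)"
  define c d where "c = Im q" and "d = Re q"
  have q: "q = of_real c * \<i> + of_real d" by (simp add: complex_eq_iff c_def d_def)
  have q2: "q\<^sup>2 = of_real Y * \<i> / w" by (simp add: q_def)
  have "(cmod q)\<^sup>2 = 1" unfolding norm_power[symmetric] q2
    using Y w by (simp add: norm_mult norm_divide)
  hence cd: "c\<^sup>2 + d\<^sup>2 = 1" by (simp add: cmod_power2 c_def d_def add.commute)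
  have q0: "q \<noteq> 0" using \<open>(cmod q)\<^sup>2 = 1\<close> by auto
  have w0: "w \<noteq> 0" using w Y by auto
  have det: "(Y * d + X * c) * d - (X * d - Y * c) * c = Y"
  proof -
    have "(Y * d + X * c) * d - (X * d - Y * c) * c = Y * (c\<^sup>2 + d\<^sup>2)"
      by (simp add: algebra_simps power2_eq_square)
    thus ?thesis using cd by simp
  qed
  have z: "z = of_real X + of_real Y * \<i>" by (simp add: complex_eq_iff X_def Y_def)
  have "(of_real (Y * d + X * c) * \<i> + of_real (X * d - Y * c)) = z * q"
    by (simp add: z q algebra_simps)
  hence "real_mob (Y * d + X * c) (X * d - Y * c) c d \<i> = z"
    using q0 by (simp add: real_mob_def q)
  moreover have "of_real Y * \<i> / q\<^sup>2 = w"
    using q2 q0 w0 by (simp add: nonzero_divide_eq_eq nonzero_eq_divide_eq mult.commute)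
  ultimately have "v = tangent (Y * d + X * c) (X * d - Y * c) c d"
    unfolding tangent_def det by (simp add: v q)
  thus ?thesis using that[of "Y * d + X * c" d "X * d - Y * c" c] det Y by simp
qed

lemma tangent_scale: "s \<noteq> 0 \<Longrightarrow> tangent (s*a) (s*b) (s*c) (s*d) = tangent a b c d"
proof -
  assume s: "s \<noteq> 0"
  have "of_real (s * a * (s * d) - s * b * (s * c)) * \<i> / (of_real (s * c) * \<i> + of_real (s * d))\<^sup>2
    = of_real (s\<^sup>2) * (of_real (a * d - b * c) * \<i>) / (of_real (s\<^sup>2) * (of_real c * \<i> + of_real d)\<^sup>2)"
    by (simp add: algebra_simps power2_eq_square)
  thus ?thesis using s by (simp add: tangent_def real_mob_scale)
qed

text \<open>A unit tangent vector determines its matrix up to a nonzero real factor: equal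
  directions make (c' i + d')^2 a positive multiple of (c i + d)^2, a square root leaves a sign, and
  equal base points then fix the top row. The factor does not affect \<open>geo\<close>.\<close>

lemma geo_eq_if_tangent_eq:
  assumes "a * d - b * c > 0" "a' * d' - b' * c' > 0"
    and eq: "tangent a b c d = tangent a' b' c' d'"
  shows "geo a b c d = geo a' b' c' d'"
proof -
  define D D' where "D = a * d - b * c" and "D' = a' * d' - b' * c'"
  define q q' where "q = of_real c * \<i> + (of_real d :: complex)" and "q' = of_real c' * \<i> + (of_real d' :: complex)"
  have q0: "q \<noteq> 0" "q' \<noteq> 0" unfolding q_def q'_def 
    using real_mob_denom_nz[OF assms(1), of \<i>] real_mob_denom_nz[OF assms(2), of \<i>] by auto
  have DD: "D > 0" "D' > 0" using assms by (simp_all add: D_def D'_def)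
  have "of_real D * \<i> / q\<^sup>2 = of_real D' * \<i> / q'\<^sup>2"
    using eq by (simp add: tangent_def D_def D'_def q_def q'_def)
  hence 1: "of_real D * q'\<^sup>2 = of_real D' * q\<^sup>2"
    using q0 by (simp add: field_simps)
  have "(of_real (sqrt D) * q')\<^sup>2 = (of_real (sqrt D') * q)\<^sup>2"
    using 1 DD by (simp add: power_mult_distrib flip: of_real_power)
  hence "of_real (sqrt D) * q' = of_real (sqrt D') * q \<or> of_real (sqrt D) * q' = - of_real (sqrt D') * q"
    unfolding power2_eq_iff by simp
  then obtain s where s: "s \<noteq> 0" "q' = of_real s * q"
  proof (elim disjE)
    assume "of_real (sqrt D) * q' = of_real (sqrt D') * q"
    hence "q' = of_real (sqrt D' / sqrt D) * q" using DD by (simp add: field_simps)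
    thus ?thesis using that[of "sqrt D' / sqrt D"] DD by simp
  next
    assume "of_real (sqrt D) * q' = - of_real (sqrt D') * q"
    hence "q' = of_real (- sqrt D' / sqrt D) * q" using DD by (simp add: field_simps)
    thus ?thesis using that[of "- sqrt D' / sqrt D"] DD by simp
  qed
  have cd: "c' = s * c" "d' = s * d" using s(2) by (auto simp: complex_eq_iff q_def q'_def)
  have "(of_real a * \<i> + of_real b) / q = (of_real a' * \<i> + of_real b') / q'"
    using eq by (simp add: tangent_def real_mob_def q_def q'_def)
  hence "of_real a' * \<i> + (of_real b'::complex) = of_real s * (of_real a * \<i> + of_real b)"
  proof -
    assume "(of_real a * \<i> + of_real b) / q = (of_real a' * \<i> + of_real b') / q'"
    hence "of_real a' * \<i> + (of_real b'::complex) = (of_real a * \<i> + of_real b) / q * q'"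
      using q0 by simp
    thus ?thesis using q0 by (simp add: s(2))
  qed
  hence ab: "a' = s * a" "b' = s * b" by (auto simp: complex_eq_iff)
  show ?thesis unfolding cd ab by (simp add: geo_def[abs_def] real_mob_scale s)
qed

text \<open>Evaluates the definite description in \<open>curve_of\<close>: every competing curve is
  some \<open>geo\<close>, and its position and velocity at time 0 fix it.\<close>

lemma curve_of_tangent:
  assumes "a * d - b * c > 0"
  shows "curve_of (tangent a b c d) = geo a b c d"
  unfolding curve_of_def
proof (rule the_equality)
  show "unit_speed_geodesic (geo a b c d) \<and> geo a b c d 0 = fst (tangent a b c d) \<and>
    (geo a b c d has_vector_derivative snd (tangent a b c d)) (at 0)"
    using unit_speed_geo[OF assms] geo_has_vector_derivative[OF assms, of 0]
    by (simp add: geo_0 tangent_def)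
next
  fix g assume g: "unit_speed_geodesic g \<and> g 0 = fst (tangent a b c d) \<and>
    (g has_vector_derivative snd (tangent a b c d)) (at 0)"
  then obtain a' b' c' d' where M': "a' * d' - b' * c' > 0" "g = geo a' b' c' d'"
    unfolding unit_speed_geodesic_iff by blast
  have "(g has_vector_derivative snd (tangent a' b' c' d')) (at 0)"
    using geo_has_vector_derivative[OF M'(1), of 0] M'(2) by simp
  hence "snd (tangent a' b' c' d') = snd (tangent a b c d)"
    using g vector_derivative_unique_at by blast
  moreover have "fst (tangent a' b' c' d') = fst (tangent a b c d)"
    using g M'(2) by (simp add: geo_0 tangent_def)
  ultimately show "g = geo a b c d"
    using geo_eq_if_tangent_eq[OF M'(1) assms] M'(2) by (simp add: prod_eq_iff)
qed

lemma flow_H_tangent: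
  assumes "a * d - b * c > 0"
  shows "flow_H t (tangent a b c d) = tangent (a * exp t) b (c * exp t) d"
proof -
  have "vector_derivative (geo a b c d) (at t) = snd (tangent (a * exp t) b (c * exp t) d)"
    using geo_has_vector_derivative[OF assms] by (rule vector_derivative_at)
  moreover have "geo a b c d t = fst (tangent (a * exp t) b (c * exp t) d)"
    using geo_add[of a b c d t 0] by (simp add: geo_0 tangent_def)
  ultimately show ?thesis
    by (simp add: flow_H_def curve_of_tangent[OF assms] prod_eq_iff)
qed

lemma flow_H_in_T1H: "v \<in> T1H \<Longrightarrow> flow_H t v \<in> T1H"
  by (erule ex_tangent) (simp add: flow_H_tangent tangent_in_T1H det_scale_pos)

lemma flow_H_flow_H: "v \<in> T1H \<Longrightarrow> flow_H s (flow_H t v) = flow_H (t + s) v"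
  by (erule ex_tangent) (simp add: flow_H_tangent det_scale_pos exp_add mult.assoc)

lemma geodesic_of_vec_tangent:
  "a * d - b * c > 0 \<Longrightarrow> geodesic_of_vec (tangent a b c d) = geodesic_of (geo a b c d)"
  by (simp add: geodesic_of_vec_def curve_of_tangent)

lemma geodesic_of_shift: "geodesic_of (\<lambda>t. c (s + t)) = geodesic_of c"
proof -
  have "(\<lambda>t. c (r + t)) \<in> range (\<lambda>r t. c (s + (r + t)))" for r
    by (rule range_eqI[of _ _ "r - s"]) (simp add: add.assoc[symmetric])
  thus ?thesis by (auto simp: geodesic_of_def add.assoc[symmetric])
qed

lemma geodesic_of_vec_flow_H: "v \<in> T1H \<Longrightarrow> geodesic_of_vec (flow_H t v) = geodesic_of_vec v"
proof (erule ex_tangent)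
  fix a b c d assume M: "a * d - b * c > (0::real)" "v = tangent a b c d"
  have "geo (a * exp t) b (c * exp t) d = (\<lambda>s. geo a b c d (t + s))"
    by (simp add: geo_add)
  thus "geodesic_of_vec (flow_H t v) = geodesic_of_vec v"
    using M by (simp add: flow_H_tangent geodesic_of_vec_tangent det_scale_pos geodesic_of_shift)
qed

lemma geodesics_eq: "geodesics = geodesic_of_vec ` T1H"
proof (intro equalityI subsetI)
  fix \<gamma> assume "\<gamma> \<in> geodesics"
  then obtain a b c d where "a * d - b * c > 0" "\<gamma> = geodesic_of (geo a b c d)"
    by (auto simp: geodesics_def unit_speed_geodesic_iff)
  thus "\<gamma> \<in> geodesic_of_vec ` T1H"
    using tangent_in_T1H geodesic_of_vec_tangent by (metis image_eqI)
next
  fix \<gamma> assume "\<gamma> \<in> geodesic_of_vec ` T1H"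
  thus "\<gamma> \<in> geodesics"
    by (auto simp: geodesics_def geodesic_of_vec_tangent unit_speed_geo elim!: ex_tangent)
qed

section \<open>Endpoints of a geodesic as column ratios of its matrix\<close>

lemma tendsto_bdry_unique:
  assumes "tendsto_bdry c b F" "tendsto_bdry c b' F" "F \<noteq> bot"
  shows "b = b'"
  using assms not_tendsto_and_filterlim_at_infinity[OF assms(3), of c]
  by (cases b; cases b') (auto simp: tendsto_bdry_def dest: tendsto_unique[OF assms(3)])

lemma real_mob_tendsto_at_infinity:
  assumes "a * d - b * c > 0"
  shows "tendsto_bdry (\<lambda>s. real_mob a b c d (of_real s * \<i>)) (if c = 0 then Infty_pt else Real_pt (a / c)) at_top"
proof (cases "c = 0")
  case True
  hence ad: "a \<noteq> 0" "d \<noteq> 0" using assms by auto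
  have "filterlim (\<lambda>s. of_real (b / d) + of_real (a / d) * \<i> * of_real s :: complex) at_infinity at_top"
    by (intro tendsto_add_filterlim_at_infinity[OF tendsto_const]
          tendsto_mult_filterlim_at_infinity[OF tendsto_const] filterlim_of_real_at_infinity) (use ad in auto)
  moreover have "(\<lambda>s. of_real (b / d) + of_real (a / d) * \<i> * of_real s) = (\<lambda>s. real_mob a b c d (of_real s * \<i>))"
    using ad True by (auto simp: real_mob_def add_divide_distrib mult_ac)
  ultimately show ?thesis using True by (simp add: tendsto_bdry_def)
next
  case False
  \<comment> \<open>Partial fractions: (a z + b)/(c z + d) = a/c - ((a d - b c)/c)/(c z +
    d).\<close>
  have "((\<lambda>s. of_real (a/c) - of_real ((a*d-b*c)/c) / (of_real d + of_real c * \<i> * of_real s)) \<longlongrightarrow>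
     of_real (a/c) - (0::complex)) at_top"
    by (intro tendsto_intros tendsto_divide_0[OF tendsto_const]
          tendsto_add_filterlim_at_infinity[OF tendsto_const]
          tendsto_mult_filterlim_at_infinity[OF tendsto_const] filterlim_of_real_at_infinity)
      (use False in auto)
  moreover have "\<forall>\<^sub>F s in at_top. of_real (a/c) - of_real ((a*d-b*c)/c) / (of_real d + of_real c * \<i> * of_real s)
     = real_mob a b c d (of_real s * \<i>)"
    using eventually_gt_at_top[of 0]
  proof eventually_elim
    case (elim s)
    hence "of_real c * (of_real s * \<i>) + of_real d \<noteq> (0::complex)"
      using real_mob_denom_nz[OF assms, of "of_real s * \<i>"] by simp
    hence nz: "of_real d + of_real c * \<i> * of_real s \<noteq> (0::complex)" by (simp add: mult_ac add.commute)
    have "of_real (a/c) * (of_real d + of_real c * \<i> * of_real s) - of_real ((a*d-b*c)/c)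
        = of_real a * (of_real s * \<i>) + (of_real b :: complex)"
      using False by (simp add: complex_eq_iff field_simps)
    hence "real_mob a b c d (of_real s * \<i>) = (of_real (a/c) * (of_real d + of_real c * \<i> * of_real s)
        - of_real ((a*d-b*c)/c)) / (of_real d + of_real c * \<i> * of_real s)"
      by (simp add: real_mob_def add.commute mult_ac)
    thus ?case using nz by (simp only: diff_divide_distrib nonzero_mult_div_cancel_right not_False_eq_True)
  qed
  ultimately show ?thesis using False
    by (auto simp: tendsto_bdry_def elim: Lim_transform_eventually)
qed

lemma geo_tendsto_at_top:
  assumes "a * d - b * c > 0"
  shows "tendsto_bdry (geo a b c d) (if c = 0 then Infty_pt else Real_pt (a / c)) at_top"
proof -
  have "tendsto_bdry (\<lambda>t. real_mob a b c d (of_real (exp t) * \<i>)) (if c = 0 then Infty_pt else Real_pt (a / c)) at_top"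
    using real_mob_tendsto_at_infinity[OF assms] exp_at_top
    by (auto simp: tendsto_bdry_def intro: filterlim_compose[of _ _ at_top])
  thus ?thesis by (simp add: geo_def[abs_def])
qed

lemma geo_tendsto_at_bot:
  assumes "a * d - b * c > 0"
  shows "tendsto_bdry (geo a b c d) (if d = 0 then Infty_pt else Real_pt (b / d)) at_bot"
proof -
  \<comment> \<open>Right multiplication by the matrix of -1/z swaps the columns up to sign and
    reverses time, so the backward limit becomes a forward one.\<close>
  have "geo a b c d t = geo b (-a) d (-c) (- t)" for t
  proof -
    have "geo a b c d t = (of_real a * (of_real (exp t) * \<i>) + of_real b) / (of_real c * (of_real (exp t) * \<i>) + of_real d)"
      by (simp add: geo_def real_mob_def)
    also have "\<dots> = ((of_real a * (of_real (exp t) * \<i>) + of_real b) * (of_real (exp (-t)) * \<i>)) 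
       / ((of_real c * (of_real (exp t) * \<i>) + of_real d) * (of_real (exp (-t)) * \<i>))" by simp
    also have "\<dots> = geo b (-a) d (-c) (- t)"
      by (simp add: geo_def real_mob_def ring_distribs exp_minus mult_ac)
    finally show ?thesis .
  qed
  hence eq: "geo a b c d = (\<lambda>t. geo b (-a) d (-c) (- t))" by blast
  have "tendsto_bdry (geo b (-a) d (-c)) (if d = 0 then Infty_pt else Real_pt (b / d)) at_top"
    using geo_tendsto_at_top[of b "-c" "-a" d] assms by (simp add: algebra_simps)
  thus ?thesis unfolding eq
    by (auto simp: tendsto_bdry_def filterlim_at_bot_mirror split: bdry.splits)
qed

lemma tendsto_bdry_shift_at_top: "tendsto_bdry c b at_top \<Longrightarrow> tendsto_bdry (\<lambda>t. c (s + t)) b at_top"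
  by (auto simp: tendsto_bdry_def split: bdry.splits
        intro!: filterlim_compose[of c _ at_top "\<lambda>t. s + t"] filterlim_tendsto_add_at_top[OF tendsto_const] filterlim_ident)

lemma tendsto_bdry_shift_at_bot: "tendsto_bdry c b at_bot \<Longrightarrow> tendsto_bdry (\<lambda>t. c (s + t)) b at_bot"
proof -
  have "filterlim (\<lambda>t. s + t) at_bot at_bot"
    unfolding filterlim_at_bot
  proof
    fix Z :: real
    show "\<forall>\<^sub>F t in at_bot. s + t \<le> Z"
      using eventually_le_at_bot[of "Z - s"] by eventually_elim simp
  qed
  thus "tendsto_bdry c b at_bot \<Longrightarrow> tendsto_bdry (\<lambda>t. c (s + t)) b at_bot"
    by (auto simp: tendsto_bdry_def split: bdry.splits intro: filterlim_compose[of c _ at_bot "\<lambda>t. s + t"])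
qed

lemma in_geodesic_of_self: "c \<in> geodesic_of c"
  by (auto simp: geodesic_of_def intro!: image_eqI[of _ _ 0])

lemma fwd_end_tangent:
  assumes "a * d - b * c > 0"
  shows "fwd_end (geodesic_of_vec (tangent a b c d)) = (if c = 0 then Infty_pt else Real_pt (a / c))"
  unfolding fwd_end_def geodesic_of_vec_tangent[OF assms]
proof (rule the_equality)
  show "\<forall>g\<in>geodesic_of (geo a b c d). tendsto_bdry g (if c = 0 then Infty_pt else Real_pt (a / c)) at_top"
    using geo_tendsto_at_top[OF assms] by (auto simp: geodesic_of_def intro!: tendsto_bdry_shift_at_top simp del: if_split)
next
  fix b' assume "\<forall>g\<in>geodesic_of (geo a b c d). tendsto_bdry g b' at_top"
  thus "b' = (if c = 0 then Infty_pt else Real_pt (a / c))"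
    using tendsto_bdry_unique[OF _ geo_tendsto_at_top[OF assms]] in_geodesic_of_self by auto
qed

lemma bwd_end_tangent:
  assumes "a * d - b * c > 0"
  shows "bwd_end (geodesic_of_vec (tangent a b c d)) = (if d = 0 then Infty_pt else Real_pt (b / d))"
  unfolding bwd_end_def geodesic_of_vec_tangent[OF assms]
proof (rule the_equality)
  show "\<forall>g\<in>geodesic_of (geo a b c d). tendsto_bdry g (if d = 0 then Infty_pt else Real_pt (b / d)) at_bot"
    using geo_tendsto_at_bot[OF assms] by (auto simp: geodesic_of_def intro!: tendsto_bdry_shift_at_bot simp del: if_split)
next
  fix b' assume "\<forall>g\<in>geodesic_of (geo a b c d). tendsto_bdry g b' at_bot"
  thus "b' = (if d = 0 then Infty_pt else Real_pt (b / d))"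
    using tendsto_bdry_unique[OF _ geo_tendsto_at_bot[OF assms]] in_geodesic_of_self by auto
qed


section \<open>The theta group and the Farey tiling\<close>

definition int_mat :: "int \<Rightarrow> int \<Rightarrow> int \<Rightarrow> int \<Rightarrow> imat" where
  "int_mat p q r s = vector [vector [p, q], vector [r, s]]"

lemma int_mat_nth [simp]:
  "int_mat p q r s $ 1 $ 1 = p" "int_mat p q r s $ 1 $ 2 = q" "int_mat p q r s $ 2 $ 1 = r" "int_mat p q r s $ 2 $ 2 = s"
  by (simp_all add: int_mat_def)

lemma imat_eq_iff: "(A :: imat) = B \<longleftrightarrow> A$1$1 = B$1$1 \<and> A$1$2 = B$1$2 \<and> A$2$1 = B$2$1 \<and> A$2$2 = B$2$2"
  by (auto simp: vec_eq_iff forall_2)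

lemma imat_cases: obtains p q r s where "A = int_mat p q r s"
  using that[of "A$1$1" "A$1$2" "A$2$1" "A$2$2"] by (simp add: imat_eq_iff)

lemma int_mat_mult: "int_mat p q r s ** int_mat p' q' r' s' =
    int_mat (p * p' + q * r') (p * q' + q * s') (r * p' + s * r') (r * q' + s * s')"
  by (simp add: imat_eq_iff matrix_matrix_mult_def sum_2)

lemma tau_int_mat: "tau = int_mat 1 2 0 1" and sigma_int_mat: "sigma = int_mat 0 (-1) 1 0"
  and mat_1_int_mat: "mat 1 = int_mat 1 0 0 1"
  by (simp_all add: tau_def sigma_def int_mat_def[symmetric] imat_eq_iff mat_def)

lemma int_mat_in_theta: "int_mat p q r s \<in> theta_group \<longleftrightarrow> p * s - q * r = 1 \<and>
    ((odd p \<and> even q \<and> even r \<and> odd s) \<or> (even p \<and> odd q \<and> odd r \<and> even s))"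
  by (auto simp: theta_group_def mat_cong_def forall_2 det_2 mat_1_int_mat sigma_int_mat cong_iff_dvd_diff)

lemma mat_1_in_theta: "mat 1 \<in> theta_group"
  by (simp add: mat_1_int_mat int_mat_in_theta)

lemma theta_mult: "A \<in> theta_group \<Longrightarrow> B \<in> theta_group \<Longrightarrow> A ** B \<in> theta_group"
proof -
  assume A: "A \<in> theta_group" and B: "B \<in> theta_group"
  obtain p q r s p' q' r' s' where int_mat: "A = int_mat p q r s" "B = int_mat p' q' r' s'"
    by (metis imat_cases)
  have "(p * p' + q * r') * (r * q' + s * s') - (p * q' + q * s') * (r * p' + s * r')
     = (p * s - q * r) * (p' * s' - q' * r')" by (simp add: algebra_simps)
  thus ?thesis using A B unfolding int_mat int_mat_mult int_mat_in_theta by auto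
qed

lemma theta_inverse:
  assumes "A \<in> theta_group"
  obtains B where "B \<in> theta_group" "A ** B = mat 1" "B ** A = mat 1"
proof -
  obtain p q r s where int_mat: "A = int_mat p q r s" by (metis imat_cases)
  show ?thesis
    by (rule that[of "int_mat s (-q) (-r) p"]) (use assms in \<open>auto simp: int_mat int_mat_in_theta int_mat_mult mat_1_int_mat imat_eq_iff algebra_simps\<close>)
qed

section \<open>The action on points, tangent vectors and geodesics, and its orbits\<close>

lemma mob_int_mat: "mob (int_mat p q r s) = real_mob (of_int p) (of_int q) (of_int r) (of_int s)"
  by (simp add: mob_def[abs_def] real_mob_def[abs_def])

lemma theta_det: "int_mat p q r s \<in> theta_group \<Longrightarrow> of_int p * of_int s - of_int q * of_int r = (1::real)"
  unfolding int_mat_in_theta by (metis of_int_1 of_int_diff of_int_mult)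

lemma mob_compose:
  assumes "A \<in> theta_group" "B \<in> theta_group" "Im z > 0"
  shows "mob A (mob B z) = mob (A ** B) z"
proof -
  obtain p q r s p' q' r' s' where int_mat: "A = int_mat p q r s" "B = int_mat p' q' r' s'"
    by (metis imat_cases)
  show ?thesis unfolding int_mat mob_int_mat int_mat_mult
    by (subst real_mob_compose) (use assms theta_det in \<open>auto simp: int_mat\<close>)
qed

lemma Im_mob_pos:
  assumes "A \<in> theta_group" "Im z > 0"
  shows "Im (mob A z) > 0"
proof -
  obtain p q r s where int_mat: "A = int_mat p q r s" by (metis imat_cases)
  show ?thesis unfolding int_mat mob_int_mat
    by (rule Im_real_mob_pos) (use assms theta_det in \<open>auto simp: int_mat\<close>)
qed

lemma tangent_det_mult:
  assumes "int_mat p q r s \<in> theta_group"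
  shows "(of_int p * a + of_int q * c) * (of_int r * b + of_int s * d)
       - (of_int p * b + of_int q * d) * (of_int r * a + of_int s * c) = a * d - b * (c::real)"
proof -
  have "(of_int p * a + of_int q * c) * (of_int r * b + of_int s * d)
       - (of_int p * b + of_int q * d) * (of_int r * a + of_int s * c)
     = (of_int p * of_int s - of_int q * of_int r) * (a * d - b * c)" by (simp add: algebra_simps)
  thus ?thesis using theta_det[OF assms] by simp
qed

lemma mob_T_tangent:
  assumes A: "int_mat p q r s \<in> theta_group" and M: "a * d - b * c > 0"
  shows "mob_T (int_mat p q r s) (tangent a b c d) = tangent (of_int p * a + of_int q * c) (of_int p * b + of_int q * d)
     (of_int r * a + of_int s * c) (of_int r * b + of_int s * d)"
proof -
  let ?z = "real_mob a b c d \<i>"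
  have z: "Im ?z > 0" by (rule Im_real_mob_pos[OF M]) auto
  have nz: "of_real (of_int r) * ?z + of_real (of_int s) \<noteq> 0"
    by (rule real_mob_denom_nz[OF _ z, of "of_int p" _ "of_int q"]) (use theta_det[OF A] in auto)
  have nz': "of_real c * \<i> + of_real d \<noteq> (0::complex)" by (rule real_mob_denom_nz[OF M]) auto
  have "deriv (mob (int_mat p q r s)) ?z = 1 / (of_real (of_int r) * ?z + of_real (of_int s))\<^sup>2"
    unfolding mob_int_mat
    by (rule DERIV_imp_deriv) (use real_mob_has_field_derivative[OF nz, of "of_int p" "of_int q"] theta_det[OF A] in simp)
  moreover have "(of_real c * \<i> + of_real d) * (of_real (of_int r) * ?z + of_real (of_int s)) =
     of_real (of_int r * a + of_int s * c) * \<i> + of_real (of_int r * b + of_int s * d)"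
    using nz' by (simp add: real_mob_def field_simps)
  moreover have "mob (int_mat p q r s) ?z = real_mob (of_int p * a + of_int q * c) (of_int p * b + of_int q * d)
     (of_int r * a + of_int s * c) (of_int r * b + of_int s * d) \<i>"
    unfolding mob_int_mat by (rule real_mob_compose[OF M]) auto
  ultimately show ?thesis
    unfolding tangent_def[of "of_int p * a + of_int q * c"] tangent_det_mult[OF A]
    by (simp add: mob_T_def tangent_def power_mult_distrib[symmetric])
qed

lemma mob_T_in_T1H: "A \<in> theta_group \<Longrightarrow> v \<in> T1H \<Longrightarrow> mob_T A v \<in> T1H"
  by (cases A rule: imat_cases, erule ex_tangent) (simp add: mob_T_tangent tangent_in_T1H tangent_det_mult)

lemma flow_H_mob_T: "A \<in> theta_group \<Longrightarrow> v \<in> T1H \<Longrightarrow> flow_H t (mob_T A v) = mob_T A (flow_H t v)"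
  by (cases A rule: imat_cases, erule ex_tangent)
     (simp add: mob_T_tangent flow_H_tangent tangent_det_mult det_scale_pos, simp add: algebra_simps)

lemma mob_T_mat_1: "mob_T (mat 1) v = v" if "v \<in> T1H"
  using that by (auto simp: mat_1_int_mat mob_T_tangent mat_1_in_theta[unfolded mat_1_int_mat] elim!: ex_tangent)

lemma mob_T_compose:
  assumes "A \<in> theta_group" "B \<in> theta_group" "v \<in> T1H"
  shows "mob_T A (mob_T B v) = mob_T (A ** B) v"
proof -
  obtain p q r s p' q' r' s' where int_mat: "A = int_mat p q r s" "B = int_mat p' q' r' s'"
    by (metis imat_cases)
  obtain a b c d where v: "a * d - b * c > 0" "v = tangent a b c d" using assms(3) by (rule ex_tangent)
  have "int_mat p q r s ** int_mat p' q' r' s' \<in> theta_group" using assms theta_mult by (simp add: int_mat)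
  thus ?thesis using assms(1,2) v unfolding int_mat int_mat_mult
    by (simp add: mob_T_tangent tangent_det_mult, simp add: algebra_simps)
qed

lemma fst_mob_T: "fst (mob_T A v) = mob A (fst v)"
  by (simp add: mob_T_def case_prod_beta)

lemma geodesic_of_vec_mob_T:
  assumes "A \<in> theta_group" "v \<in> T1H"
  shows "geodesic_of_vec (mob_T A v) = mob_geodesic A (geodesic_of_vec v)"
proof -
  obtain p q r s where int_mat: "A = int_mat p q r s" by (metis imat_cases)
  obtain a b c d where v: "a * d - b * c > 0" "v = tangent a b c d" using assms(2) by (rule ex_tangent)
  have "geo (of_int p * a + of_int q * c) (of_int p * b + of_int q * d)
     (of_int r * a + of_int s * c) (of_int r * b + of_int s * d) t = mob A (geo a b c d t)" for t
    using real_mob_compose[OF v(1)] by (simp add: geo_def int_mat mob_int_mat)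
  thus ?thesis using assms(1) v
    by (simp add: int_mat mob_T_tangent geodesic_of_vec_tangent tangent_det_mult geodesic_of_def mob_geodesic_def o_def image_image)
qed

lemma proj_T_mob_T_subset:
  "A \<in> theta_group \<Longrightarrow> v \<in> T1H \<Longrightarrow> proj_T (mob_T A v) \<subseteq> proj_T v"
  by (auto simp: proj_T_def mob_T_compose theta_mult)

lemma proj_T_eq_iff:
  assumes "v \<in> T1H" "w \<in> T1H"
  shows "proj_T v = proj_T w \<longleftrightarrow> (\<exists>A\<in>theta_group. mob_T A v = w)"
proof
  assume "proj_T v = proj_T w"
  moreover have "w \<in> proj_T w" unfolding proj_T_def
    using mat_1_in_theta mob_T_mat_1[OF assms(2)] by (metis image_eqI)
  ultimately have "w \<in> proj_T v" by simp
  thus "\<exists>A\<in>theta_group. mob_T A v = w" by (auto simp: proj_T_def)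
next
  assume "\<exists>A\<in>theta_group. mob_T A v = w"
  then obtain A where A: "A \<in> theta_group" "mob_T A v = w" by blast
  obtain B where B: "B \<in> theta_group" "B ** A = mat 1" using theta_inverse[OF A(1)] by metis
  have "mob_T B w = v"
    using mob_T_compose[OF B(1) A(1) assms(1)] mob_T_mat_1[OF assms(1)] A B by simp
  thus "proj_T v = proj_T w"
    using proj_T_mob_T_subset[OF A(1) assms(1)] proj_T_mob_T_subset[OF B(1) assms(2)] A by auto
qed

lemma proj_T_mob_T: "A \<in> theta_group \<Longrightarrow> v \<in> T1H \<Longrightarrow> proj_T (mob_T A v) = proj_T v"
  using proj_T_eq_iff mob_T_in_T1H by metis

lemma flow_M_proj_T: "v \<in> T1H \<Longrightarrow> flow_M t (proj_T v) = proj_T (flow_H t v)"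
  by (auto simp: flow_M_def proj_T_def flow_H_mob_T image_image)

lemma base_M_proj_T: "base_M (proj_T v) = proj_H (fst v)"
  by (simp add: base_M_def proj_T_def proj_H_def image_image fst_mob_T)

lemma proj_H_mob:
  assumes "A \<in> theta_group" "Im z > 0"
  shows "proj_H (mob A z) = proj_H z"
proof -
  obtain B where B: "B \<in> theta_group" "B ** A = mat 1" using theta_inverse[OF assms(1)] by metis
  have "mob (mat 1) z = z" by (simp add: mat_1_int_mat mob_int_mat real_mob_def)
  show ?thesis unfolding proj_H_def
  proof (intro equalityI subsetI; elim imageE)
    fix C x assume "C \<in> theta_group" "x = mob C (mob A z)"
    thus "x \<in> (\<lambda>A. mob A z) ` theta_group"
      using assms by (auto simp: mob_compose intro: theta_mult)
  next
    fix C x assume C: "C \<in> theta_group" "x = mob C z"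
    have "z = mob B (mob A z)" using assms B \<open>mob (mat 1) z = z\<close> by (simp add: mob_compose)
    hence "x = mob (C ** B) (mob A z)" using C B assms Im_mob_pos mob_compose by metis
    thus "x \<in> (\<lambda>B. mob B (mob A z)) ` theta_group" using C B theta_mult by blast
  qed
qed

text \<open>The vertical lines \<open>Re z = \<plusminus>1\<close> are Farey edges joining a cusp equivalent to \<open>1\<close> and
  a cusp equivalent to \<open>\<infinity>\<close>; their images under \<open>theta_group\<close> have the endpoints \<open>-q/p\<close> and \<open>-s/r\<close>
  in the following equation.\<close>

lemma Re_mob_eq_1_iff:
  assumes "int_mat m n r s \<in> theta_group" "Im z > 0" "p = m - r" "q = n - s"
  shows "Re (mob (int_mat m n r s) z) = 1 \<longleftrightarrow>
    of_int (p * r) * (cmod z)\<^sup>2 + of_int (p * s + q * r) * Re z + of_int (q * s) = 0"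
    and "odd p" "odd q" "odd (r + s)" "p * s - q * r = 1"
proof -
  have "of_real (of_int r) * z + of_real (of_int s) \<noteq> 0"
    by (rule real_mob_denom_nz[of "of_int m" _ "of_int n"]) (use assms theta_det[OF assms(1)] in auto)
  hence pos: "(cmod (of_real (of_int r) * z + of_real (of_int s)))\<^sup>2 > 0" by simp
  have "(cmod (of_real (of_int r) * z + of_real (of_int s)))\<^sup>2 =
     (of_int r)\<^sup>2 * (cmod z)\<^sup>2 + 2 * of_int r * of_int s * Re z + (of_int s)\<^sup>2"
    unfolding cmod_power2 by (simp add: power2_eq_square algebra_simps)
  \<comment> \<open>Since A z - 1 = (p z + q)/(r z + s), the right-hand side is the real part of (p
    z + q) times the conjugate of r z + s.\<close>
  hence "(of_int m * of_int r * (cmod z)\<^sup>2 + (of_int m * of_int s + of_int n * of_int r) * Re z + of_int n * of_int s)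
     - (cmod (of_real (of_int r) * z + of_real (of_int s)))\<^sup>2
     = of_int (p * r) * (cmod z)\<^sup>2 + of_int (p * s + q * r) * Re z + of_int (q * s)"
    unfolding assms(3,4) by (simp add: power2_eq_square algebra_simps)
  thus "Re (mob (int_mat m n r s) z) = 1 \<longleftrightarrow>
    of_int (p * r) * (cmod z)\<^sup>2 + of_int (p * s + q * r) * Re z + of_int (q * s) = 0"
    unfolding mob_int_mat Re_real_mob using pos by (subst divide_eq_1_iff) linarith
qed (use assms in \<open>auto simp: int_mat_in_theta algebra_simps\<close>)

text \<open>With x = Re z and N = |z|^2 the expression vanishes on the edge with endpoints -q/p and
  -s/r. If r and s are nonzero, then p s and q r are nonzero consecutive integers, hence of one
  sign; passing to absolute values, a zero would put the positive rationals Q/P and S/R strictly on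
  opposite sides of 1, impossible for Farey neighbours. Oddness of p and q excludes edges such as
  the imaginary axis, which does cut the quadrilateral.\<close>

lemma farey_edge_avoids_quadrilateral:
  fixes p q r s :: int and x N :: real
  assumes det: "p * s - q * r = 1" and odd: "odd p" "odd q" "odd (r + s)"
    and x: "\<bar>x\<bar> < 1" "\<bar>x\<bar> < N"
  shows "of_int (p * r) * N + of_int (p * s + q * r) * x + of_int (q * s) \<noteq> 0"
proof
  assume eq: "of_int (p * r) * N + of_int (p * s + q * r) * x + of_int (q * s) = 0"
  have pq: "p \<noteq> 0" "q \<noteq> 0" using odd by auto
  consider "r = 0" | "s = 0" | "r \<noteq> 0" "s \<noteq> 0" by blast
  thus False
  proof cases
    case 1
    hence "p * s = 1" using det by simp
    hence "x = - of_int (q * s)" using eq 1 by simp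
    hence "\<bar>x\<bar> = of_int \<bar>q * s\<bar>" by simp
    moreover have "\<bar>q * s\<bar> \<ge> 1" using pq \<open>p * s = 1\<close> by (metis abs_ge_zero abs_eq_0 int_one_le_iff_zero_less less_le mult_eq_0_iff mult_zero_right zero_neq_one)
    ultimately show False using x by linarith
  next
    case 2
    hence qr: "q * r = -1" using det by simp
    hence "of_int (p * r) * N = x" using eq 2 by simp
    hence "\<bar>of_int (p * r) * N\<bar> = \<bar>x\<bar>" by simp
    hence "of_int \<bar>p * r\<bar> * N = \<bar>x\<bar>" using x by (simp add: abs_mult)
    moreover have "\<bar>p * r\<bar> \<ge> 1" using pq qr by (metis abs_ge_zero abs_eq_0 int_one_le_iff_zero_less less_le mult_eq_0_iff mult_zero_right zero_neq_neg_one)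
    hence "of_int \<bar>p * r\<bar> * N \<ge> 1 * N" using x by (intro mult_right_mono) linarith+
    ultimately show False using x by linarith
  next
    case 3
    define P Q R S where "P = \<bar>p\<bar>" and "Q = \<bar>q\<bar>" and "R = \<bar>r\<bar>" and "S = \<bar>s\<bar>"
    have pos: "P \<ge> 1" "Q \<ge> 1" "R \<ge> 1" "S \<ge> 1" using pq 3 by (auto simp: P_def Q_def R_def S_def)
    have abs_add: "\<bar>u + v\<bar> = \<bar>u\<bar> + \<bar>v\<bar>" if "u * v > 0" for u v :: real
      using that by (auto simp: zero_less_mult_iff)
    have "q * r \<noteq> 0" "q * r + 1 \<noteq> 0" using pq 3 det by (auto simp: algebra_simps)
    hence "(q * r + 1 > 0 \<and> q * r > 0) \<or> (q * r + 1 < 0 \<and> q * r < 0)" by linarith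
    hence "(q * r + 1) * (q * r) > 0" by (metis mult_pos_pos mult_neg_neg)
    hence same: "(p * s) * (q * r) > 0" using det by (simp add: algebra_simps)
    have abs_det: "P * S - Q * R = 1 \<or> P * S - Q * R = -1"
      using det same unfolding P_def Q_def R_def S_def abs_mult[symmetric]
      by (auto simp: zero_less_mult_iff abs_if)
    have "of_int (p * s) * of_int (q * r) > (0::real)"
      using same by (simp only: of_int_mult[symmetric] of_int_0_less_iff)
    from abs_add[OF this] have "\<bar>of_int (p * s + q * r) :: real\<bar> = of_int (P * S + Q * R)"
      by (simp add: P_def Q_def R_def S_def abs_mult)
    moreover have "\<bar>of_int (p * r) * N + of_int (q * s)\<bar> = of_int (P * R) * N + of_int (Q * S)"
    proof -
      have N: "N > 0" using x by linarith
      have "of_int (p * r) * of_int (q * s) > (0::real)"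
        using same by (simp only: of_int_mult[symmetric] of_int_0_less_iff mult_ac)
      hence "of_int (p * r) * N * of_int (q * s) > 0" using N
        by (metis mult.assoc mult.commute mult_pos_pos)
      from abs_add[OF this] show ?thesis using N
        by (simp add: P_def Q_def R_def S_def abs_mult)
    qed
    moreover have "of_int (p * r) * N + of_int (q * s) = - of_int (p * s + q * r) * x"
      using eq by (simp only: mult_minus_left eq_neg_iff_add_eq_0 add_ac)
    ultimately have eq': "of_int (P * R) * N + of_int (Q * S) = of_int (P * S + Q * R) * \<bar>x\<bar>"
      by (simp add: abs_mult del: of_int_mult of_int_add)
    have "of_int (P * R) * \<bar>x\<bar> < of_int (P * R) * N"
      using x pos by (intro mult_strict_left_mono) (auto intro: mult_pos_pos)
    moreover have "of_int (Q * S) * \<bar>x\<bar> < of_int (Q * S) * 1"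
      using x pos by (intro mult_strict_left_mono) (auto intro: mult_pos_pos)
    ultimately have "of_int (P * R) * \<bar>x\<bar> + of_int (Q * S) * \<bar>x\<bar> < of_int (P * S + Q * R) * \<bar>x\<bar>"
      using eq' by linarith
    hence "of_int ((P - Q) * (S - R)) * \<bar>x\<bar> > 0" by (simp add: algebra_simps)
    hence "(P - Q) * (S - R) > 0" by (auto simp: zero_less_mult_iff simp del: of_int_mult of_int_diff)
    hence "(P > Q \<and> S > R) \<or> (P < Q \<and> S < R)" by (auto simp: zero_less_mult_iff)
    thus False
    proof
      assume "P > Q \<and> S > R"
      hence "(Q + 1) * (R + 1) \<le> P * S" using pos by (intro mult_mono) auto
      thus False using abs_det pos by (auto simp: algebra_simps)
    next
      assume "P < Q \<and> S < R"
      hence "(P + 1) * (S + 1) \<le> Q * R" using pos by (intro mult_mono) auto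
      thus False using abs_det pos by (auto simp: algebra_simps)
    qed
  qed
qed

text \<open>The open ideal quadrilateral with vertices -1, 0, 1 and infinity: the second condition
  keeps z outside the circles with diameters [-1, 0] and [0, 1].\<close>

definition quad :: "complex set" where
  "quad = {z. \<bar>Re z\<bar> < 1 \<and> \<bar>Re z\<bar> < (cmod z)\<^sup>2 \<and> 0 < Im z}"

lemma tau_shift_in_theta: "int_mat 1 (2 * n) 0 1 \<in> theta_group"
  by (simp add: int_mat_in_theta)

lemma Re_mob_ne_1:
  assumes "A \<in> theta_group" "z \<in> quad"
  shows "Re (mob A z) \<noteq> 1"
proof -
  obtain m n r s where A: "A = int_mat m n r s" by (metis imat_cases)
  note * = Re_mob_eq_1_iff[OF assms(1)[unfolded A] _ refl refl, of z]
  show ?thesis unfolding A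
    using * farey_edge_avoids_quadrilateral[OF *(5,2,3,4)] assms(2) by (simp add: quad_def)
qed

lemma mob_shift:
  assumes "A \<in> theta_group" "Im z > 0"
  shows "mob (int_mat 1 (2 * n) 0 1 ** A) z = mob A z + of_int (2 * n)"
  unfolding mob_compose[OF tau_shift_in_theta assms, symmetric] by (simp add: mob_int_mat real_mob_def)

lemma Re_mob_quad:
  assumes "A \<in> theta_group" "z \<in> quad"
  shows "Re (mob A z) \<noteq> 1" "Re (mob A z) \<noteq> -1"
proof -
  show "Re (mob A z) \<noteq> 1" by (rule Re_mob_ne_1[OF assms])
  have "Re (mob (int_mat 1 (2 * 1) 0 1 ** A) z) \<noteq> 1"
    by (rule Re_mob_ne_1) (use assms tau_shift_in_theta theta_mult in blast)+
  thus "Re (mob A z) \<noteq> -1"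
    using assms by (subst (asm) mob_shift) (auto simp: quad_def)
qed

text \<open>With Y the squared height of z, the edge equation is p r Y + (p + q)(r + s) = 0. If r
  were nonzero, p (r + s) and r (p + q) would have opposite signs, yet they differ by exactly 1. So
  r = 0: the edge is not turned or crossed, and only plus or minus the identity remains.\<close>

lemma stabilizer_of_vertical_line:
  assumes A: "int_mat m n r s \<in> theta_group" and z: "Im z > 0" "Re z = 1" "Re (mob (int_mat m n r s) z) = 1"
  shows "n = 0 \<and> r = 0 \<and> s = m \<and> (m = 1 \<or> m = -1)"
proof -
  define p q where "p = m - r" and "q = n - s"
  note * = Re_mob_eq_1_iff[OF A z(1) p_def q_def]
  define Y where "Y = (Im z)\<^sup>2"
  have Y: "Y > 0" using z by (simp add: Y_def)
  have "(cmod z)\<^sup>2 = 1 + Y" using z by (simp add: cmod_power2 Y_def)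
  hence "of_int (p * r) * (1 + Y) + of_int (p * s + q * r) + of_int (q * s) = (0::real)"
    using *(1) z by simp
  hence eq: "of_int (p * r) * Y + of_int ((p + q) * (r + s)) = (0::real)"
    by (simp add: algebra_simps)
  have det: "p * (r + s) - r * (p + q) = 1" using *(5) by (simp add: algebra_simps)
  have p0: "p \<noteq> 0" "r + s \<noteq> 0" using *(2,4) by (metis dvd_0_right)+
  have "r = 0"
  proof (rule ccontr)
    assume "r \<noteq> 0"
    hence pr: "p * r \<noteq> 0" using p0 by simp
    have "(of_int (p * r) * of_int ((p + q) * (r + s)) :: real) = - ((of_int (p * r))\<^sup>2 * Y)"
      using eq by (simp add: power2_eq_square eq_neg_iff_add_eq_0 mult.assoc flip: distrib_left)
    also have "\<dots> < 0" using pr Y by (simp add: zero_less_mult_iff)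
    finally have "(p * r) * ((p + q) * (r + s)) < 0" 
      by (simp only: of_int_mult[symmetric] of_int_less_0_iff)
    hence "(p * (r + s)) * (r * (p + q)) < 0" by (simp add: mult_ac)
    moreover have "p * (r + s) = r * (p + q) + 1" using det by linarith
    ultimately show False 
      using mult_less_0_iff[of "p * (r + s)" "r * (p + q)"] by linarith
  qed
  hence "p + q = 0" using eq p0 by simp
  moreover have "m * s = 1" using A \<open>r = 0\<close> by (simp add: int_mat_in_theta)
  hence "(m = 1 \<and> s = 1) \<or> (m = -1 \<and> s = -1)" by (simp add: zmult_eq_1_iff)
  ultimately show ?thesis using \<open>r = 0\<close> by (auto simp: p_def q_def)
qed

text \<open>Translations by 0 or 2 move both lines to \<open>Re z = 1\<close>, where the stabilizer
  is known. The two matrices in the conclusion differ by sign and act alike.\<close>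

lemma vertical_lines_rigid:
  assumes A: "A \<in> theta_group" and z: "Im z > 0" "Re z = of_int j" "Re (mob A z) = of_int j'"
    and j: "\<bar>j\<bar> = 1" "\<bar>j'\<bar> = 1"
  shows "A = int_mat 1 (j' - j) 0 1 \<or> A = int_mat (-1) (j - j') 0 (-1)"
proof -
  obtain i i' where i: "1 - j = 2 * i" "1 - j' = 2 * i'"
    using j by (metis abs_eq_iff' abs_1 diff_self diff_minus_eq_add mult_zero_right one_add_one mult_1_right abs_if)
  define w where "w = z + of_int (2 * i)"
  have w: "Im w > 0" "Re w = 1" using z i by (auto simp: w_def)
  have zw: "z = mob (int_mat 1 (2 * (-i)) 0 1) w" by (simp add: mob_int_mat real_mob_def w_def)
  define B where "B = int_mat 1 (2 * i') 0 1 ** A ** int_mat 1 (2 * (-i)) 0 1"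
  have B: "B \<in> theta_group" unfolding B_def using A tau_shift_in_theta theta_mult by blast
  have "Re (mob B w) = 1"
  proof -
    have "mob B w = mob A z + of_int (2 * i')"
      unfolding B_def zw matrix_mul_assoc[symmetric]
      by (subst mob_shift) (use A tau_shift_in_theta theta_mult w in \<open>auto simp: mob_compose simp del: mult_minus_right\<close>)
    thus ?thesis using z i by simp
  qed
  moreover obtain m n r s where int_mat: "A = int_mat m n r s" by (metis imat_cases)
  moreover have Bmk: "B = int_mat (m + 2 * i' * r) ((m + 2 * i' * r) * (2 * (-i)) + (n + 2 * i' * s)) r (r * (2 * (-i)) + s)"
    by (simp add: B_def int_mat int_mat_mult)
  ultimately have st: "(m + 2 * i' * r) * (2 * (-i)) + (n + 2 * i' * s) = 0 \<and> r = 0 \<and> r * (2 * (-i)) + s = m + 2 * i' * r \<and>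
      (m + 2 * i' * r = 1 \<or> m + 2 * i' * r = -1)"
    using stabilizer_of_vertical_line[of _ _ _ _ w] B w by metis
  hence "r = 0" "s = m" by auto
  with st have "n = m * (2 * i - 2 * i')" "m = 1 \<or> m = -1" by (auto simp: algebra_simps)
  moreover have "2 * i - 2 * i' = j' - j" using i by linarith
  ultimately show ?thesis unfolding int_mat using \<open>r = 0\<close> \<open>s = m\<close> by (auto simp: imat_eq_iff)
qed


section \<open>The cross section\<close>

text \<open>The vectors on the geodesic from \<open>j y\<close> to \<open>j x\<close>, where \<open>y < x\<close>; the flow scales \<open>l > 0\<close>. The sign
  \<open>j\<close> treats \<open>X_plus\<close> and its mirror image \<open>X_minus\<close> at the same time.\<close>
definition lift :: "int \<Rightarrow> real \<Rightarrow> real \<Rightarrow> real \<Rightarrow> tvec" where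
  "lift j x y l = tangent (x * l) (of_int j * y) (of_int j * l) 1"

lemma sign_cases: "\<bar>j::int\<bar> = 1 \<Longrightarrow> j = 1 \<or> j = -1"
  by auto

lemma sign_square: "\<bar>j :: int\<bar> = 1 \<Longrightarrow> of_int j * of_int j = (1 :: real)"
  by (auto simp: abs_if split: if_splits)

lemma sign_square': "\<bar>j :: int\<bar> = 1 \<Longrightarrow> of_int j * (of_int j * a) = (a :: real)"
  by (auto simp: abs_if split: if_splits)

lemma lift_det: "\<bar>j\<bar> = 1 \<Longrightarrow> l > 0 \<Longrightarrow> y < x \<Longrightarrow> (x * l) * 1 - (of_int j * y) * (of_int j * l) > (0::real)"
  by (auto simp: abs_if split: if_splits)

lemma lift_in_T1H: "\<bar>j\<bar> = 1 \<Longrightarrow> l > 0 \<Longrightarrow> y < x \<Longrightarrow> lift j x y l \<in> T1H"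
  unfolding lift_def by (rule tangent_in_T1H, rule lift_det)

lemma flow_H_lift: "\<bar>j\<bar> = 1 \<Longrightarrow> l > 0 \<Longrightarrow> y < x \<Longrightarrow> flow_H t (lift j x y l) = lift j x y (l * exp t)"
  unfolding lift_def by (subst flow_H_tangent[OF lift_det]) (auto simp: mult_ac)

lemma cmod_sign:
  assumes "\<bar>j\<bar> = 1"
  shows "(cmod (of_real (of_int j * l) * \<i> + of_real 1))\<^sup>2 = l\<^sup>2 + 1"
  using assms by (auto simp: cmod_power2 abs_if split: if_splits)

lemma fst_lift: "fst (lift j x y l) = real_mob (x * l) (of_int j * y) (of_int j * l) 1 \<i>"
  by (simp add: lift_def tangent_def)

lemma Re_lift:
  assumes "\<bar>j\<bar> = 1"
  shows "Re (fst (lift j x y l)) = of_int j * ((x * l\<^sup>2 + y) / (l\<^sup>2 + 1))"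
  unfolding fst_lift Re_real_mob cmod_sign[OF assms] by (simp add: power2_eq_square algebra_simps add_divide_distrib)

lemma Im_lift:
  assumes "\<bar>j\<bar> = 1"
  shows "Im (fst (lift j x y l)) = (x - y) * l / (l\<^sup>2 + 1)"
  unfolding fst_lift Im_real_mob cmod_sign[OF assms] by (simp add: algebra_simps sign_square[OF assms] sign_square'[OF assms])

lemma cmod_lift:
  assumes "\<bar>j\<bar> = 1"
  shows "(cmod (fst (lift j x y l)))\<^sup>2 = (x\<^sup>2 * l\<^sup>2 + y\<^sup>2) / (l\<^sup>2 + 1)"
proof -
  have pos: "l\<^sup>2 + 1 > 0" by (simp add: add_nonneg_pos)
  have "(cmod (fst (lift j x y l)))\<^sup>2 = (of_int j * of_int j) * ((x * l\<^sup>2 + y) / (l\<^sup>2 + 1))\<^sup>2 + ((x - y) * l / (l\<^sup>2 + 1))\<^sup>2"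
    unfolding cmod_power2 Re_lift[OF assms] Im_lift[OF assms] by (simp add: power2_eq_square)
  also have "\<dots> = ((x * l\<^sup>2 + y)\<^sup>2 + ((x - y) * l)\<^sup>2) / (l\<^sup>2 + 1)\<^sup>2"
    unfolding sign_square[OF assms] add_divide_distrib[of "(x * l\<^sup>2 + y)\<^sup>2"] power_divide by simp
  also have "(x * l\<^sup>2 + y)\<^sup>2 + ((x - y) * l)\<^sup>2 = (x\<^sup>2 * l\<^sup>2 + y\<^sup>2) * (l\<^sup>2 + 1)"
    by (simp add: power2_eq_square algebra_simps)
  finally show ?thesis using pos by (simp add: power2_eq_square)
qed

lemma ends_lift:
  assumes "\<bar>j\<bar> = 1" "l > 0" "y < x"
  shows "fwd_end (geodesic_of_vec (lift j x y l)) = Real_pt (of_int j * x)"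
    and "bwd_end (geodesic_of_vec (lift j x y l)) = Real_pt (of_int j * y)"
  using assms lift_det[OF assms] unfolding lift_def
  by (auto simp: fwd_end_tangent bwd_end_tangent abs_if split: if_splits)

lemma lift_of_ends:
  assumes v: "v \<in> T1H" and j: "\<bar>j\<bar> = 1" and "y < x"
    and f: "fwd_end (geodesic_of_vec v) = Real_pt (of_int j * x)"
    and b: "bwd_end (geodesic_of_vec v) = Real_pt (of_int j * y)"
  obtains l where "l > 0" "v = lift j x y l"
proof -
  obtain a b c d where M: "a * d - b * c > 0" "v = tangent a b c d" using v by (rule ex_tangent)
  have c: "c \<noteq> 0" and ac: "a = of_int j * x * c" using f M
    by (auto simp: fwd_end_tangent field_simps split: if_splits)
  have d: "d \<noteq> 0" and bd: "b = of_int j * y * d" using b M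
    by (auto simp: bwd_end_tangent field_simps split: if_splits)
  \<comment> \<open>Dividing the matrix by d makes its last entry 1; the endpoints fix everything
    but this ratio, and the determinant forces it to be positive.\<close>
  define l where "l = of_int j * c / d"
  have "a * d - b * c = (of_int j * c / d) * (d\<^sup>2 * (x - y))"
    unfolding ac bd using d by (simp add: field_simps power2_eq_square)
  hence "l * (d\<^sup>2 * (x - y)) > 0" using M by (simp add: l_def)
  moreover have "d\<^sup>2 * (x - y) > 0" using d assms by simp
  ultimately have "l > 0" by (simp add: zero_less_mult_iff)
  moreover have "tangent a b c d = tangent (d * (x * l)) (d * (of_int j * y)) (d * (of_int j * l)) (d * 1)"
    unfolding ac bd l_def using d j by (simp add: sign_square' sign_square mult_ac)
  hence "v = lift j x y l" using M(2) d by (simp only: tangent_scale lift_def not_False_eq_True)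
  ultimately show ?thesis by (rule that)
qed

text \<open>The vector at which this geodesic crosses the line \<open>Re z = j\<close>.\<close>
definition crossing :: "int \<Rightarrow> real \<Rightarrow> real \<Rightarrow> tvec" where
  "crossing j x y = lift j x y (sqrt ((1 - y) / (x - 1)))"

lemma crossing_height_pos: "1 < x \<Longrightarrow> y < 1 \<Longrightarrow> sqrt ((1 - y) / (x - 1)) > 0"
  by simp

lemma crossing_in_T1H: "\<bar>j\<bar> = 1 \<Longrightarrow> 1 < x \<Longrightarrow> y < 1 \<Longrightarrow> crossing j x y \<in> T1H"
  unfolding crossing_def by (rule lift_in_T1H) auto

lemma ends_crossing:
  assumes "\<bar>j\<bar> = 1" "1 < x" "y < 1"
  shows "fwd_end (geodesic_of_vec (crossing j x y)) = Real_pt (of_int j * x)"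
    and "bwd_end (geodesic_of_vec (crossing j x y)) = Real_pt (of_int j * y)"
  unfolding crossing_def using assms by (simp_all add: ends_lift)

text \<open>Source of the height in \<open>crossing\<close>: after clearing the denominator the
  condition is x l^2 + y = l^2 + 1, linear in l^2.\<close>

lemma Re_lift_eq_iff:
  assumes "\<bar>j\<bar> = 1" "l > 0" "1 < x"
  shows "Re (fst (lift j x y l)) = of_int j \<longleftrightarrow> l\<^sup>2 = (1 - y) / (x - 1)"
proof -
  have pos: "l\<^sup>2 + 1 > 0" by (simp add: add_nonneg_pos)
  have "Re (fst (lift j x y l)) = of_int j \<longleftrightarrow> (x * l\<^sup>2 + y) / (l\<^sup>2 + 1) = 1"
    unfolding Re_lift[OF assms(1)] mult_cancel_left2 using assms(1) by auto
  also have "\<dots> \<longleftrightarrow> x * l\<^sup>2 + y = l\<^sup>2 + 1" using pos by (simp add: divide_eq_eq)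
  also have "\<dots> \<longleftrightarrow> l\<^sup>2 = (1 - y) / (x - 1)" using assms(3) by (auto simp: field_simps)
  finally show ?thesis .
qed

lemma Re_crossing:
  assumes "\<bar>j\<bar> = 1" "1 < x" "y < 1"
  shows "Re (fst (crossing j x y)) = of_int j"
  unfolding crossing_def by (subst Re_lift_eq_iff) (use assms in auto)

lemma lift_eq_crossing:
  assumes "\<bar>j\<bar> = 1" "l > 0" "1 < x" "Re (fst (lift j x y l)) = of_int j"
  shows "lift j x y l = crossing j x y"
  using assms by (simp add: Re_lift_eq_iff crossing_def real_sqrt_unique)

lemma sqrt3: "1 < sqrt 3" "sqrt 3 < 2"
  by (auto simp: real_less_rsqrt real_less_lsqrt)

text \<open>The second factor of \<open>I_plus\<close>. That of \<open>I_minus\<close> is its mirror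
  image, which is why the open and closed ends are exchanged there; the sign \<open>j\<close>
  absorbs this.\<close>

definition back_interval :: "real set" where
  "back_interval = {- sqrt 3..<2 - sqrt 3}"

lemma ends_in_iff: "ends_in \<gamma> I \<longleftrightarrow> (\<exists>(x, y)\<in>I. fwd_end \<gamma> = Real_pt x \<and> bwd_end \<gamma> = Real_pt y)"
  by (force simp: ends_in_def)

lemma ends_in_I_plus: "ends_in \<gamma> I_plus \<longleftrightarrow>
    (\<exists>x y. 1 < x \<and> y \<in> back_interval \<and> fwd_end \<gamma> = Real_pt (of_int 1 * x) \<and> bwd_end \<gamma> = Real_pt (of_int 1 * y))"
  by (auto simp: ends_in_iff I_plus_def back_interval_def)

lemma ends_in_I_minus: "ends_in \<gamma> I_minus \<longleftrightarrow>
    (\<exists>x y. 1 < x \<and> y \<in> back_interval \<and> fwd_end \<gamma> = Real_pt (of_int (-1) * x) \<and> bwd_end \<gamma> = Real_pt (of_int (-1) * y))"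
proof
  assume "ends_in \<gamma> I_minus"
  then obtain x y where "x < -1" "sqrt 3 - 2 < y" "y \<le> sqrt 3" "fwd_end \<gamma> = Real_pt x" "bwd_end \<gamma> = Real_pt y"
    by (auto simp: ends_in_iff I_minus_def)
  thus "\<exists>x y. 1 < x \<and> y \<in> back_interval \<and> fwd_end \<gamma> = Real_pt (of_int (-1) * x) \<and> bwd_end \<gamma> = Real_pt (of_int (-1) * y)"
    by (intro exI[of _ "-x"] exI[of _ "-y"]) (auto simp: back_interval_def)
next
  assume "\<exists>x y. 1 < x \<and> y \<in> back_interval \<and> fwd_end \<gamma> = Real_pt (of_int (-1) * x) \<and> bwd_end \<gamma> = Real_pt (of_int (-1) * y)"
  then obtain x y where "1 < x" "y \<in> back_interval" "fwd_end \<gamma> = Real_pt (- x)" "bwd_end \<gamma> = Real_pt (- y)"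
    by auto
  thus "ends_in \<gamma> I_minus"
    unfolding ends_in_iff by (intro bexI[of _ "(- x, - y)"]) (auto simp: I_minus_def back_interval_def)
qed

lemma back_interval_lt_1: "y \<in> back_interval \<Longrightarrow> y < 1"
  using sqrt3 unfolding back_interval_def atLeastLessThan_iff by linarith

lemma X_set_iff: "v \<in> X_set \<longleftrightarrow> (\<exists>j x y. \<bar>j\<bar> = 1 \<and> 1 < x \<and> y \<in> back_interval \<and> v = crossing j x y)"
proof
  assume "v \<in> X_set"
  then obtain j where j: "\<bar>j\<bar> = 1" "v \<in> T1H" "Re (fst v) = of_int j" and
    "\<exists>x y. 1 < x \<and> y \<in> back_interval \<and> fwd_end (geodesic_of_vec v) = Real_pt (of_int j * x)
       \<and> bwd_end (geodesic_of_vec v) = Real_pt (of_int j * y)"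
    unfolding X_set_def X_plus_def X_minus_def ends_in_I_plus ends_in_I_minus
    by (elim UnE CollectE) (metis abs_1 of_int_1, metis abs_1 abs_minus_cancel of_int_1 of_int_minus)
  then obtain x y where xy: "1 < x" "y \<in> back_interval" "fwd_end (geodesic_of_vec v) = Real_pt (of_int j * x)"
    "bwd_end (geodesic_of_vec v) = Real_pt (of_int j * y)" by blast
  have "y < x" using xy back_interval_lt_1 by fastforce
  then obtain l where "l > 0" "v = lift j x y l" using lift_of_ends[OF j(2,1) _ xy(3,4)] by blast
  thus "\<exists>j x y. \<bar>j\<bar> = 1 \<and> 1 < x \<and> y \<in> back_interval \<and> v = crossing j x y"
    using lift_eq_crossing j xy by metis
next
  assume "\<exists>j x y. \<bar>j\<bar> = 1 \<and> 1 < x \<and> y \<in> back_interval \<and> v = crossing j x y"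
  then obtain j x y where j: "\<bar>j\<bar> = 1" "1 < x" "y \<in> back_interval" "v = crossing j x y" by blast
  note y = back_interval_lt_1[OF j(3)]
  show "v \<in> X_set"
    using sign_cases[OF j(1)] j crossing_in_T1H[OF j(1,2) y] Re_crossing[OF j(1,2) y] ends_crossing[OF j(1,2) y]
    unfolding X_set_def X_plus_def X_minus_def ends_in_I_plus ends_in_I_minus by auto
qed

lemma A_set_iff: "\<gamma> \<in> A_set \<longleftrightarrow> (\<exists>j x y. \<bar>j\<bar> = 1 \<and> 1 < x \<and> y \<in> back_interval \<and> \<gamma> = geodesic_of_vec (crossing j x y))"
proof
  assume "\<gamma> \<in> A_set"
  then obtain j where j: "\<bar>j\<bar> = 1" "\<gamma> \<in> geodesics" and
    "\<exists>x y. 1 < x \<and> y \<in> back_interval \<and> fwd_end \<gamma> = Real_pt (of_int j * x) \<and> bwd_end \<gamma> = Real_pt (of_int j * y)"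
    unfolding A_set_def A_plus_def A_minus_def ends_in_I_plus ends_in_I_minus
    by (elim UnE CollectE) (metis abs_1, metis abs_1 abs_minus_cancel)
  then obtain x y v where xy: "1 < x" "y \<in> back_interval" "v \<in> T1H" "\<gamma> = geodesic_of_vec v"
    "fwd_end (geodesic_of_vec v) = Real_pt (of_int j * x)"
    "bwd_end (geodesic_of_vec v) = Real_pt (of_int j * y)" by (auto simp: geodesics_eq)
  note y = back_interval_lt_1[OF xy(2)]
  have "y < x" using xy y by simp
  then obtain l where l: "l > 0" "v = lift j x y l" using lift_of_ends[OF xy(3) j(1) _ xy(5,6)] by blast
  \<comment> \<open>Flowing multiplies the height by exp t, so the logarithm of the ratio of heights
    leads to the crossing while the geodesic stays the same.\<close>
  have "flow_H (ln (sqrt ((1 - y) / (x - 1)) / l)) v = crossing j x y"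
    unfolding l(2) crossing_def using l(1) \<open>y < x\<close> crossing_height_pos[OF xy(1) y] j by (simp add: flow_H_lift exp_ln)
  hence "\<gamma> = geodesic_of_vec (crossing j x y)" using xy geodesic_of_vec_flow_H by metis
  thus "\<exists>j x y. \<bar>j\<bar> = 1 \<and> 1 < x \<and> y \<in> back_interval \<and> \<gamma> = geodesic_of_vec (crossing j x y)" using j xy by blast
next
  assume "\<exists>j x y. \<bar>j\<bar> = 1 \<and> 1 < x \<and> y \<in> back_interval \<and> \<gamma> = geodesic_of_vec (crossing j x y)"
  then obtain j x y where j: "\<bar>j\<bar> = 1" "1 < x" "y \<in> back_interval" "\<gamma> = geodesic_of_vec (crossing j x y)" by blast
  note y = back_interval_lt_1[OF j(3)]
  have "\<gamma> \<in> geodesics" using geodesics_eq crossing_in_T1H j y by blast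
  thus "\<gamma> \<in> A_set"
    using sign_cases[OF j(1)] j ends_crossing[OF j(1,2) y]
    unfolding A_set_def A_plus_def A_minus_def ends_in_I_plus ends_in_I_minus by auto
qed

lemma crossing_ends_inject:
  assumes "\<bar>j\<bar> = 1" "1 < x" "y < 1" "\<bar>j'\<bar> = 1" "1 < x'" "y' < 1"
    and "geodesic_of_vec (crossing j x y) = geodesic_of_vec (crossing j' x' y')"
  shows "j = j' \<and> x = x' \<and> y = y'"
proof -
  have "of_int j * x = of_int j' * x'" "of_int j * y = of_int j' * y'"
    using ends_crossing[OF assms(1-3)] ends_crossing[OF assms(4-6)] assms(7) by auto
  thus ?thesis using sign_cases[OF assms(1)] sign_cases[OF assms(4)] assms by auto
qed

text \<open>An element of the theta group relating the two vectors maps a point of one vertical line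
  to a point of another, so up to sign it is the translation by j' - j. If j' = -j, this would give
  x' = 2 - x < 1. The range y < 1 is wider than the section, so that crossings that are not returns
  are covered too.\<close>

lemma proj_T_crossing_inject:
  assumes j: "\<bar>j\<bar> = 1" "1 < x" "y < 1" "\<bar>j'\<bar> = 1" "1 < x'" "y' < 1"
    and eq: "proj_T (crossing j x y) = proj_T (crossing j' x' y')"
  shows "j = j' \<and> x = x' \<and> y = y'"
proof -
  obtain A where A: "A \<in> theta_group" "mob_T A (crossing j x y) = crossing j' x' y'"
    using eq proj_T_eq_iff crossing_in_T1H j by metis
  define l where "l = sqrt ((1 - y) / (x - 1))"
  have l: "l > 0" using j by (simp add: l_def)
  have "y < x" using j by simp
  note det = lift_det[OF j(1) l this]
  have im: "Im (fst (crossing j x y)) > 0" using crossing_in_T1H[OF j(1-3)] by (auto simp: T1H_def upper_half_plane_def)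
  have crA: "crossing j' x' y' = mob_T A (tangent (x * l) (of_int j * y) (of_int j * l) 1)"
    using A(2) by (simp add: crossing_def lift_def l_def)
  have "Re (mob A (fst (crossing j x y))) = of_int j'"
    using A Re_crossing[OF j(4-6)] by (simp flip: fst_mob_T)
  hence "A = int_mat 1 (j' - j) 0 1 \<or> A = int_mat (-1) (j - j') 0 (-1)"
    using vertical_lines_rigid[OF A(1) im Re_crossing[OF j(1-3)] _ j(1,4)] by blast
  hence "crossing j' x' y' = tangent (x * l + of_int (j' - j) * (of_int j * l)) (of_int j * y + of_int (j' - j)) (of_int j * l) 1"
  proof
    assume A': "A = int_mat 1 (j' - j) 0 1"
    show ?thesis unfolding crA A' mob_T_tangent[OF A(1)[unfolded A'] det] by simp
  next
    assume A': "A = int_mat (-1) (j - j') 0 (-1)"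
    have "crossing j' x' y' = tangent ((-1) * (x * l + of_int (j' - j) * (of_int j * l))) ((-1) * (of_int j * y + of_int (j' - j))) ((-1) * (of_int j * l)) ((-1) * 1)"
      unfolding crA A' mob_T_tangent[OF A(1)[unfolded A'] det] by (simp add: algebra_simps)
    thus ?thesis by (simp only: tangent_scale)
  qed
  moreover have "(x * l + of_int (j' - j) * (of_int j * l)) * 1 - (of_int j * y + of_int (j' - j)) * (of_int j * l) > 0"
    using det j by (simp add: algebra_simps)
  ultimately have "fwd_end (geodesic_of_vec (crossing j' x' y')) = Real_pt ((x * l + of_int (j' - j) * (of_int j * l)) / (of_int j * l))"
     "bwd_end (geodesic_of_vec (crossing j' x' y')) = Real_pt (of_int j * y + of_int (j' - j))"
    using l j by (auto simp: fwd_end_tangent bwd_end_tangent)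
  moreover have "(x * l + of_int (j' - j) * (of_int j * l)) / (of_int j * l) = of_int j * x + of_int (j' - j)"
    using l sign_cases[OF j(1)] by (auto simp: field_simps)
  ultimately have "of_int j' * x' = of_int j * x + of_int (j' - j)" "of_int j' * y' = of_int j * y + of_int (j' - j)"
    using ends_crossing[OF j(4-6)] by auto
  thus ?thesis using sign_cases[OF j(1)] sign_cases[OF j(4)] j by auto
qed

text \<open>Membership in the section can be decided upstairs, because no two crossings with y < 1
  are identified.\<close>

lemma proj_T_crossing_in_section_iff:
  assumes "\<bar>j\<bar> = 1" "1 < x" "y < 1"
  shows "proj_T (crossing j x y) \<in> proj_T ` X_set \<longleftrightarrow> y \<in> back_interval"
proof
  assume "proj_T (crossing j x y) \<in> proj_T ` X_set"
  then obtain j' x' y' where *: "\<bar>j'\<bar> = 1" "1 < x'" "y' \<in> back_interval" "proj_T (crossing j x y) = proj_T (crossing j' x' y')"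
    by (auto simp: X_set_iff)
  thus "y \<in> back_interval" using proj_T_crossing_inject[OF assms *(1,2) back_interval_lt_1[OF *(3)] *(4)] by simp
next
  assume "y \<in> back_interval"
  thus "proj_T (crossing j x y) \<in> proj_T ` X_set" using assms X_set_iff by blast
qed

lemma inj_on_proj_T: "inj_on proj_T X_set"
proof (rule inj_onI)
  fix v w assume "v \<in> X_set" "w \<in> X_set" and eq: "proj_T v = proj_T w"
  then obtain j x y j' x' y' where *: "\<bar>j\<bar> = 1" "1 < x" "y \<in> back_interval" "v = crossing j x y"
     "\<bar>j'\<bar> = 1" "1 < x'" "y' \<in> back_interval" "w = crossing j' x' y'"
    unfolding X_set_iff by blast
  thus "v = w"
    using proj_T_crossing_inject[OF *(1,2) back_interval_lt_1[OF *(3)] *(5,6) back_interval_lt_1[OF *(7)]] eq by simp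
qed


section \<open>Crossing one tile\<close>

abbreviation (input) section_M :: "tvec set set" where
  "section_M \<equiv> proj_T ` X_set"

definition trans_mat :: "int \<Rightarrow> imat" where
  "trans_mat j = int_mat 1 (-2 * j) 0 1"

text \<open>The map z -> -1/(z - 2 j), which sends 2 j to infinity, j to j and 3 j to -j. It
  straightens the tile sides ending at 2 j into the lines \<open>Re z = j\<close> and
  \<open>Re z = -j\<close>.\<close>

definition rot_mat :: "int \<Rightarrow> imat" where
  "rot_mat j = int_mat 0 (-1) 1 (-2 * j)"

lemma trans_mat_in_theta: "trans_mat j \<in> theta_group" and rot_mat_in_theta: "rot_mat j \<in> theta_group"
  by (simp_all add: trans_mat_def rot_mat_def int_mat_in_theta)

lemma mob_T_trans_lift:
  assumes "\<bar>j\<bar> = 1" "l > 0" "y < x"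
  shows "mob_T (trans_mat j) (lift j x y l) = lift j (x - 2) (y - 2) l"
  using sign_square[OF assms(1)] trans_mat_in_theta[of j] lift_det[OF assms]
  unfolding lift_def trans_mat_def by (subst mob_T_tangent) (auto simp: algebra_simps sign_square'[OF assms(1)])

lemma mob_T_rot_lift:
  assumes "\<bar>j\<bar> = 1" "l > 0" "y < x"
  shows "mob_T (rot_mat j) (lift j x y l) = tangent (- (of_int j * l)) (-1) ((x - 2) * l) (of_int j * (y - 2))"
  using sign_square[OF assms(1)] rot_mat_in_theta[of j] lift_det[OF assms]
  unfolding lift_def rot_mat_def by (subst mob_T_tangent) (auto simp: algebra_simps sign_square'[OF assms(1)])

lemma sign_cancel: "\<bar>j\<bar> = 1 \<Longrightarrow> (of_int j * a) * (of_int j * b) = (a * b :: real)"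
  by (auto simp: abs_if split: if_splits)

lemma cancel_height: "b \<noteq> 0 \<Longrightarrow> (- b) * (l * a / b) = - (l * a :: real)"
  by simp

lemma cancel_heights: "a \<noteq> 0 \<Longrightarrow> b \<noteq> 0 \<Longrightarrow> (c * - b) * (1 / a * (l * a / b)) = - (c * l :: real)"
  by simp

lemma mob_T_rot_lift_lt_2:
  assumes "\<bar>j\<bar> = 1" "l > 0" "y < 1" "1 < x" "x < 2"
  shows "mob_T (rot_mat j) (lift j x y l) = lift j (1 / (2 - x)) (1 / (2 - y)) (l * (2 - x) / (2 - y))"
proof -
  \<comment> \<open>The rotated matrix has last entry j (y - 2); \<open>lift\<close> is normalised
    to last entry 1, so the two differ by this factor.\<close>
  have "lift j (1 / (2 - x)) (1 / (2 - y)) (l * (2 - x) / (2 - y)) =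
     tangent ((of_int j * (y - 2)) * (1 / (2 - x) * (l * (2 - x) / (2 - y))))
        ((of_int j * (y - 2)) * (of_int j * (1 / (2 - y))))
        ((of_int j * (y - 2)) * (of_int j * (l * (2 - x) / (2 - y))))
        ((of_int j * (y - 2)) * 1)"
    unfolding lift_def by (subst tangent_scale) (use assms in auto)
  also have "(of_int j * (y - 2)) * (1 / (2 - x) * (l * (2 - x) / (2 - y))) = - (of_int j * l)"
    using assms cancel_heights[of "2 - x" "2 - y" "of_int j" l] by simp
  also have "(of_int j * (y - 2)) * (of_int j * (1 / (2 - y))) = -1"
    using assms sign_square'[OF assms(1), of "(y - 2) / (2 - y)"] by (simp add: field_simps)
  also have "(of_int j * (y - 2)) * (of_int j * (l * (2 - x) / (2 - y))) = (x - 2) * l"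
    unfolding sign_cancel[OF assms(1)] using assms cancel_height[of "2 - y" l "2 - x"] by (simp add: left_diff_distrib right_diff_distrib mult.commute)
  finally show ?thesis using assms by (simp add: mob_T_rot_lift)
qed

text \<open>For x > 2 the forward endpoint j / (2 - x) lies on the opposite side of 0, so the sign
  becomes -j and both coordinates are negated.\<close>

lemma mob_T_rot_lift_gt_2:
  assumes "\<bar>j\<bar> = 1" "l > 0" "y < 1" "2 < x"
  shows "mob_T (rot_mat j) (lift j x y l) = lift (- j) (1 / (x - 2)) (1 / (y - 2)) (l * (x - 2) / (2 - y))"
proof -
  have "lift (- j) (1 / (x - 2)) (1 / (y - 2)) (l * (x - 2) / (2 - y)) =
     tangent ((of_int j * (y - 2)) * (1 / (x - 2) * (l * (x - 2) / (2 - y))))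
        ((of_int j * (y - 2)) * (of_int (- j) * (1 / (y - 2))))
        ((of_int j * (y - 2)) * (of_int (- j) * (l * (x - 2) / (2 - y))))
        ((of_int j * (y - 2)) * 1)"
    unfolding lift_def by (subst tangent_scale) (use assms in auto)
  also have "(of_int j * (y - 2)) * (1 / (x - 2) * (l * (x - 2) / (2 - y))) = - (of_int j * l)"
    using assms cancel_heights[of "x - 2" "2 - y" "of_int j" l] by simp
  also have "(of_int j * (y - 2)) * (of_int (- j) * (1 / (y - 2))) = -1"
    using assms sign_square[OF assms(1)] by simp
  also have "(of_int j * (y - 2)) * (of_int (- j) * (l * (x - 2) / (2 - y))) = (x - 2) * l"
    unfolding of_int_minus mult_minus_left mult_minus_right sign_cancel[OF assms(1)]
    using assms cancel_height[of "2 - y" l "x - 2"] by simp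
  finally show ?thesis using assms by (simp add: mob_T_rot_lift)
qed

section \<open>The interior of a tile misses the section\<close>

lemma Im_fst_T1H: "v \<in> T1H \<Longrightarrow> Im (fst v) > 0"
  by (auto simp: T1H_def upper_half_plane_def)

lemma quad_not_in_section:
  assumes "v \<in> T1H" "B \<in> theta_group" "fst (mob_T B v) \<in> quad"
  shows "proj_T v \<notin> section_M"
proof
  assume "proj_T v \<in> section_M"
  then obtain w where w: "w \<in> X_set" "proj_T (mob_T B v) = proj_T w"
    using proj_T_mob_T[OF assms(2,1)] by auto
  obtain j x y where j: "\<bar>j\<bar> = 1" "1 < x" "y \<in> back_interval" "w = crossing j x y" using w X_set_iff by blast
  note y = back_interval_lt_1[OF j(3)]
  obtain A where A: "A \<in> theta_group" "mob_T A (mob_T B v) = w"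
    using w(2) proj_T_eq_iff mob_T_in_T1H[OF assms(2,1)] crossing_in_T1H[OF j(1,2) y] j(4) by metis
  have "Re (mob A (fst (mob_T B v))) = of_int j"
    using A(2) Re_crossing[OF j(1,2) y] j(4) by (simp flip: fst_mob_T)
  thus False using Re_mob_quad[OF A(1) assms(3)] sign_cases[OF j(1)] by auto
qed

text \<open>Along \<open>lift j x y\<close>, lying on a given side of an edge of the tile is an affine inequality in \<open>l\<^sup>2\<close>,
  so it holds between two crossings as soon as it holds at both.\<close>

lemma lift_not_in_section:
  assumes j: "\<bar>j\<bar> = 1" "l > 0" "y < 1" "1 < x"
    and "1 - y < (x - 1) * l\<^sup>2" "(x - 3) * l\<^sup>2 < 3 - y"
    and "(x - 1) * (x - 2) * l\<^sup>2 + (1 - y) * (2 - y) > 0"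
    and "(x - 2) * (x - 3) * l\<^sup>2 + (2 - y) * (3 - y) > 0"
  shows "proj_T (lift j x y l) \<notin> section_M"
proof (rule quad_not_in_section[OF _ trans_mat_in_theta[of j]])
  have yx: "y < x" using j by simp
  show "lift j x y l \<in> T1H" using lift_in_T1H j by simp
  \<comment> \<open>For j = 1, translation by -2 turns the tile into \<open>quad\<close>. The four
    inequalities on l^2 correspond in order to the sides \<open>Re z = 1\<close>,
    \<open>Re z = 3\<close> and the semicircles over [1, 2] and [2, 3].\<close>
  define X Y where "X = x - 2" and "Y = y - 2"
  have pos: "l\<^sup>2 + 1 > 0" by (simp add: add_nonneg_pos)
  define r where "r = (X * l\<^sup>2 + Y) / (l\<^sup>2 + 1)"
  have Re: "Re (fst (lift j X Y l)) = of_int j * r"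
    unfolding r_def by (rule Re_lift[OF j(1)])
  have abs: "\<bar>Re (fst (lift j X Y l))\<bar> = \<bar>r\<bar>" unfolding Re using sign_cases[OF j(1)] by auto
  have "r < 1" unfolding r_def using assms pos by (simp add: X_def Y_def divide_simps algebra_simps)
  moreover have "- 1 < r" unfolding r_def using assms pos by (simp add: X_def Y_def divide_simps algebra_simps)
  moreover have "r < (X\<^sup>2 * l\<^sup>2 + Y\<^sup>2) / (l\<^sup>2 + 1)"
    unfolding r_def using assms(8) pos
    by (intro divide_strict_right_mono) (simp_all add: X_def Y_def power2_eq_square algebra_simps)
  moreover have "- r < (X\<^sup>2 * l\<^sup>2 + Y\<^sup>2) / (l\<^sup>2 + 1)"
    unfolding r_def minus_divide_left using assms(7) pos
    by (intro divide_strict_right_mono) (simp_all add: X_def Y_def power2_eq_square algebra_simps)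
  moreover have "Im (fst (lift j X Y l)) > 0"
    unfolding Im_lift[OF j(1)] using pos j by (simp add: X_def Y_def)
  ultimately have "fst (lift j X Y l) \<in> quad"
    unfolding quad_def mem_Collect_eq abs cmod_lift[OF j(1)] by (simp add: abs_less_iff)
  thus "fst (mob_T (trans_mat j) (lift j x y l)) \<in> quad"
    unfolding mob_T_trans_lift[OF j(1,2) yx] X_def Y_def .
qed

text \<open>Only the open time interval must avoid the section. Whether w is a return or a crossing
  to be skipped is decided separately, so that moves can be chained; \<open>B\<close> records the
  group element for comparison with \<open>rho\<close>.\<close>

definition moves_to :: "tvec \<Rightarrow> imat \<Rightarrow> tvec \<Rightarrow> bool" where
  "moves_to v B w \<longleftrightarrow> v \<in> T1H \<and> B \<in> theta_group \<and> (\<exists>t>0. mob_T B (flow_H t v) = w \<and>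
     (\<forall>s. 0 < s \<and> s < t \<longrightarrow> proj_T (flow_H s v) \<notin> section_M))"

lemma moves_toE:
  assumes "moves_to v B w"
  obtains t where "v \<in> T1H" "w \<in> T1H" "B \<in> theta_group" "t > 0" "mob_T B (flow_H t v) = w"
    and "\<And>s. 0 < s \<Longrightarrow> s < t \<Longrightarrow> proj_T (flow_H s v) \<notin> section_M"
    and "\<And>s. flow_H s w = mob_T B (flow_H (t + s) v)"
    and "\<And>s. proj_T (flow_H s w) = proj_T (flow_H (t + s) v)"
proof -
  obtain t where v: "v \<in> T1H" and B: "B \<in> theta_group" and t: "t > 0" "mob_T B (flow_H t v) = w"
    and nt: "\<And>s. 0 < s \<Longrightarrow> s < t \<Longrightarrow> proj_T (flow_H s v) \<notin> section_M"
    using assms unfolding moves_to_def by blast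
  have w: "w \<in> T1H" using mob_T_in_T1H[OF B flow_H_in_T1H[OF v]] t(2) by metis
  have fw: "flow_H s w = mob_T B (flow_H (t + s) v)" for s
    using t(2) flow_H_mob_T[OF B flow_H_in_T1H[OF v]] flow_H_flow_H[OF v] by metis
  have "proj_T (flow_H s w) = proj_T (flow_H (t + s) v)" for s
    unfolding fw using proj_T_mob_T B flow_H_in_T1H[OF v] by blast
  with v w B t nt fw show ?thesis by (rule that)
qed

lemma moves_to_avoids:
  assumes t: "v \<in> T1H" "B \<in> theta_group" "mob_T B (flow_H t v) = w" "proj_T w \<notin> section_M"
    and nt: "\<And>s. 0 < s \<Longrightarrow> s < t \<Longrightarrow> proj_T (flow_H s v) \<notin> section_M"
    and pw: "\<And>s. proj_T (flow_H s w) = proj_T (flow_H (t + s) v)"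
    and s: "0 < s" "s > t \<Longrightarrow> proj_T (flow_H (s - t) w) \<notin> section_M"
  shows "proj_T (flow_H s v) \<notin> section_M"
proof -
  consider "s < t" | "s = t" | "s > t" by linarith
  thus ?thesis
  proof cases
    case 1 thus ?thesis using nt s by blast
  next
    case 2
    have "proj_T (flow_H t v) = proj_T w" using proj_T_mob_T[OF t(2) flow_H_in_T1H[OF t(1)]] t(3) by metis
    thus ?thesis using t(4) 2 by simp
  next
    case 3
    thus ?thesis using pw[of "s - t"] s(2) by simp
  qed
qed

lemma moves_to_trans:
  assumes "moves_to v B w" "proj_T w \<notin> section_M" "moves_to w B' w'"
  shows "moves_to v (B' ** B) w'"
  using assms(1)
proof (rule moves_toE)
  fix t assume v: "v \<in> T1H" and B: "B \<in> theta_group" and t: "t > 0" "mob_T B (flow_H t v) = w"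
    and nt: "\<And>s. 0 < s \<Longrightarrow> s < t \<Longrightarrow> proj_T (flow_H s v) \<notin> section_M"
    and fw: "\<And>s. flow_H s w = mob_T B (flow_H (t + s) v)"
    and pw: "\<And>s. proj_T (flow_H s w) = proj_T (flow_H (t + s) v)"
  obtain t' where B': "B' \<in> theta_group" and t': "t' > 0" "mob_T B' (flow_H t' w) = w'"
    and nt': "\<And>s. 0 < s \<Longrightarrow> s < t' \<Longrightarrow> proj_T (flow_H s w) \<notin> section_M"
    using assms(3) unfolding moves_to_def by blast
  have "mob_T (B' ** B) (flow_H (t + t') v) = w'"
    using t'(2) unfolding fw using mob_T_compose[OF B' B flow_H_in_T1H[OF v]] by simp
  moreover have "proj_T (flow_H s v) \<notin> section_M" if "0 < s" "s < t + t'" for s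
    using moves_to_avoids[OF v B t(2) assms(2) nt pw] nt'[of "s - t"] that by simp
  ultimately show ?thesis unfolding moves_to_def using v B B' theta_mult t(1) t'(1)
    by (intro conjI exI[of _ "t + t'"]) auto
qed

definition lost :: "tvec \<Rightarrow> bool" where
  "lost v \<longleftrightarrow> v \<in> T1H \<and> (\<forall>t>0. proj_T (flow_H t v) \<notin> section_M) \<and> escapes_to_cusp (proj_T v)"

lemma escapes_to_cusp_proj_T:
  "v \<in> T1H \<Longrightarrow> escapes_to_cusp (proj_T v) \<longleftrightarrow> (\<exists>b. is_cusp b \<and>
     (\<forall>h>0. \<forall>\<^sub>F t in at_top. proj_H (fst (flow_H t v)) \<in> proj_H ` horoball b h))"
  unfolding escapes_to_cusp_def by (simp add: flow_M_proj_T base_M_proj_T)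

lemma lost_step:
  assumes "moves_to v B w" "proj_T w \<notin> section_M" "lost w"
  shows "lost v"
  using assms(1)
proof (rule moves_toE)
  fix t assume v: "v \<in> T1H" and w: "w \<in> T1H" and B: "B \<in> theta_group" and t: "mob_T B (flow_H t v) = w"
    and nt: "\<And>s. 0 < s \<Longrightarrow> s < t \<Longrightarrow> proj_T (flow_H s v) \<notin> section_M"
    and pw: "\<And>s. proj_T (flow_H s w) = proj_T (flow_H (t + s) v)"
  have "proj_T (flow_H s v) \<notin> section_M" if "0 < s" for s
    using moves_to_avoids[OF v B t assms(2) nt pw that] assms(3) by (simp add: lost_def)
  moreover have "escapes_to_cusp (proj_T v)"
  proof -
    obtain b where b: "is_cusp b" 
      and ev: "\<And>h. h > 0 \<Longrightarrow> \<forall>\<^sub>F t in at_top. proj_H (fst (flow_H t w)) \<in> proj_H ` horoball b h"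
      using assms(3) escapes_to_cusp_proj_T[OF w] unfolding lost_def by blast
    have pH: "proj_H (fst (flow_H s w)) = proj_H (fst (flow_H (t + s) v))" for s
      using pw[of s] by (metis base_M_proj_T)
    have "\<forall>\<^sub>F s in at_top. proj_H (fst (flow_H s v)) \<in> proj_H ` horoball b h" if h: "h > 0" for h
    proof -
      obtain N where "\<And>s. s \<ge> N \<Longrightarrow> proj_H (fst (flow_H (t + s) v)) \<in> proj_H ` horoball b h"
        using ev[OF h] unfolding pH eventually_at_top_linorder by blast
      from this[of "s - t" for s]
      have "\<And>s. s \<ge> t + N \<Longrightarrow> proj_H (fst (flow_H s v)) \<in> proj_H ` horoball b h"
        by simp
      thus ?thesis unfolding eventually_at_top_linorder by blast
    qed
    thus ?thesis using escapes_to_cusp_proj_T[OF v] b by blast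
  qed
  ultimately show ?thesis using v by (simp add: lost_def)
qed

text \<open>Replaces time by the height l = l0 exp t, in which the sides of the tile have algebraic
  equations.\<close>

lemma moves_to_crossing:
  fixes j x y l1
  defines "l0 \<equiv> sqrt ((1 - y) / (x - 1))"
  assumes j: "\<bar>j\<bar> = 1" "1 < x" "y < 1" and B: "B \<in> theta_group"
    and l1: "l0 < l1" "mob_T B (lift j x y l1) = w"
    and avoid: "\<And>l. l0 < l \<Longrightarrow> l < l1 \<Longrightarrow> proj_T (lift j x y l) \<notin> section_M"
  shows "moves_to (crossing j x y) B w"
proof -
  have l0: "l0 > 0" using j by (simp add: l0_def)
  have "y < x" using j by simp
  have flow: "flow_H t (crossing j x y) = lift j x y (l0 * exp t)" for t
    unfolding crossing_def l0_def[symmetric] by (rule flow_H_lift) fact+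
  have "ln (l1 / l0) > 0" using l0 l1 by simp
  moreover have "l0 * exp (ln (l1 / l0)) = l1" using l0 l1 by (simp add: exp_ln)
  moreover have "l0 < l0 * exp s \<and> l0 * exp s < l1" if "0 < s" "s < ln (l1 / l0)" for s
  proof -
    have "exp s < l1 / l0" using that l0 l1 by (metis exp_less_mono exp_ln divide_pos_pos less_trans)
    thus ?thesis using l0 that by (simp add: field_simps)
  qed
  ultimately show ?thesis
    unfolding moves_to_def flow using crossing_in_T1H[OF j] B l1(2) avoid
    by (intro conjI exI[of _ "ln (l1 / l0)"]) auto
qed

lemma height_gt:
  assumes "1 < x" "y < 1" "sqrt ((1 - y) / (x - 1)) < l"
  shows "1 - y < (x - 1) * l\<^sup>2" "l > 0"
proof -
  show "l > 0" using assms by (smt (verit) crossing_height_pos)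
  have "(sqrt ((1 - y) / (x - 1)))\<^sup>2 < l\<^sup>2" using assms by (intro power_strict_mono) auto
  thus "1 - y < (x - 1) * l\<^sup>2" using assms by (simp add: field_simps)
qed

lemma moves_to_gt_3:
  assumes j: "\<bar>j\<bar> = 1" "3 < x" "y < 1"
  shows "moves_to (crossing j x y) (trans_mat j) (crossing j (x - 2) (y - 2))"
proof (rule moves_to_crossing[where ?l1.0 = "sqrt ((3 - y) / (x - 3))"])
  show "sqrt ((1 - y) / (x - 1)) < sqrt ((3 - y) / (x - 3))"
    unfolding real_sqrt_less_iff using j by (intro frac_less) auto
  \<comment> \<open>The translation keeps l, so the exit height is the crossing height for the
    shifted endpoints.\<close>
  have "(1 - (y - 2)) / (x - 2 - 1) = (3 - y) / (x - 3)" by simp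
  thus "mob_T (trans_mat j) (lift j x y (sqrt ((3 - y) / (x - 3)))) = crossing j (x - 2) (y - 2)"
    using j by (simp add: mob_T_trans_lift crossing_def)
  fix l assume l: "sqrt ((1 - y) / (x - 1)) < l" "l < sqrt ((3 - y) / (x - 3))"
  have x: "1 < x" using j by simp
  note gt = height_gt[OF x j(3) l(1)]
  have "l\<^sup>2 < (sqrt ((3 - y) / (x - 3)))\<^sup>2" using l gt by (intro power_strict_mono) auto
  hence "(x - 3) * l\<^sup>2 < 3 - y" using j by (simp add: field_simps)
  thus "proj_T (lift j x y l) \<notin> section_M" using gt j
    by (intro lift_not_in_section add_pos_pos mult_pos_pos) auto
qed (use j trans_mat_in_theta in auto)

lemma moves_to_between_2_3:
  assumes j: "\<bar>j\<bar> = 1" "2 < x" "x < 3" "y < 1"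
  shows "moves_to (crossing j x y) (rot_mat j) (crossing (- j) (1 / (x - 2)) (1 / (y - 2)))"
proof -
  define m where "m = sqrt ((1 - 1 / (y - 2)) / (1 / (x - 2) - 1))"
  \<comment> \<open>The rotation multiplies heights by (x - 2)/(2 - y). Undoing this from m, the
    height of the new crossing, gives the height at which the side over [2, 3] is met.\<close>
  define l1 where "l1 = m * ((2 - y) / (x - 2))"
  have m0: "(1 - 1 / (y - 2)) / (1 / (x - 2) - 1) = (3 - y) * (x - 2) / ((2 - y) * (3 - x))"
    using j by (simp add: divide_simps) (simp add: algebra_simps)
  hence mpos: "m > 0" using j by (simp add: m_def)
  hence l1pos: "l1 > 0" using j by (simp add: l1_def)
  have m2: "m\<^sup>2 = (3 - y) * (x - 2) / ((2 - y) * (3 - x))"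
    unfolding m_def m0 using j by simp
  have l12: "l1\<^sup>2 = (3 - y) * (2 - y) / ((3 - x) * (x - 2))"
    unfolding l1_def power_mult_distrib m2 using j by (simp add: power_divide power2_eq_square)
  show ?thesis
  proof (rule moves_to_crossing[where ?l1.0 = l1])
    have "(1 - y) / (x - 1) < l1\<^sup>2"
    proof -
      have "(1 - y) * ((3 - x) * (x - 2)) < (3 - y) * (2 - y) * (x - 1)"
      proof -
        have "(1 - y) * ((3 - x) * (x - 2)) < (3 - y) * ((2 - y) * (x - 1))"
        proof -
          have "(1 - y) * (3 - x) < (2 - y) * (3 - y)" using j by (intro mult_strict_mono) auto
          hence "(1 - y) * (3 - x) * (x - 2) < (2 - y) * (3 - y) * (x - 1)"
            using j by (intro mult_strict_mono) auto
          thus ?thesis by (simp add: mult_ac)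
        qed
        thus ?thesis by (simp add: mult_ac)
      qed
      thus ?thesis unfolding l12 using j by (simp add: divide_simps) 
    qed
    hence "sqrt ((1 - y) / (x - 1)) < sqrt (l1\<^sup>2)" by (simp only: real_sqrt_less_iff)
    thus "sqrt ((1 - y) / (x - 1)) < l1" using l1pos by simp
    have "l1 * (x - 2) / (2 - y) = m" using j by (simp add: l1_def)
    thus "mob_T (rot_mat j) (lift j x y l1) = crossing (- j) (1 / (x - 2)) (1 / (y - 2))"
      using j l1pos by (simp add: mob_T_rot_lift_gt_2 crossing_def m_def)
    fix l assume l: "sqrt ((1 - y) / (x - 1)) < l" "l < l1"
    have x: "1 < x" using j by simp
    note gt = height_gt[OF x j(4) l(1)]
    have "l\<^sup>2 < l1\<^sup>2" using l gt by (intro power_strict_mono) auto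
    hence "(3 - x) * (x - 2) * l\<^sup>2 < (3 - y) * (2 - y)"
      unfolding l12 using j by (subst (asm) pos_less_divide_eq) (simp_all add: mult_ac)
    hence "(x - 2) * (x - 3) * l\<^sup>2 + (2 - y) * (3 - y) > 0" by (simp add: algebra_simps)
    moreover have "(x - 3) * l\<^sup>2 \<le> 0" using j by (simp add: mult_nonpos_nonneg)
    ultimately show "proj_T (lift j x y l) \<notin> section_M" using gt j
      by (intro lift_not_in_section add_pos_pos[of "(x - 1) * (x - 2) * l\<^sup>2"] mult_pos_pos) auto
  qed (use j rot_mat_in_theta in auto)
qed

lemma moves_to_lt_2:
  assumes j: "\<bar>j\<bar> = 1" "1 < x" "x < 2" "y < 1"
  shows "moves_to (crossing j x y) (rot_mat j) (crossing j (1 / (2 - x)) (1 / (2 - y)))"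
proof -
  define m where "m = sqrt ((1 - 1 / (2 - y)) / (1 / (2 - x) - 1))"
  define l1 where "l1 = m * ((2 - y) / (2 - x))"
  have m0: "(1 - 1 / (2 - y)) / (1 / (2 - x) - 1) = (1 - y) * (2 - x) / ((2 - y) * (x - 1))"
    using j by (simp add: divide_simps)
  hence mpos: "m > 0" using j by (simp add: m_def)
  hence l1pos: "l1 > 0" using j by (simp add: l1_def)
  have m2: "m\<^sup>2 = (1 - y) * (2 - x) / ((2 - y) * (x - 1))"
    unfolding m_def m0 using j by simp
  have l12: "l1\<^sup>2 = (1 - y) * (2 - y) / ((x - 1) * (2 - x))"
    unfolding l1_def power_mult_distrib m2 using j by (simp add: power_divide power2_eq_square)
  show ?thesis
  proof (rule moves_to_crossing[where ?l1.0 = l1])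
    have "(1 - y) / (x - 1) < l1\<^sup>2"
    proof -
      have "(1 - y) / (x - 1) * 1 < (1 - y) / (x - 1) * ((2 - y) / (2 - x))"
        using j by (intro mult_strict_left_mono) auto
      thus ?thesis unfolding l12 by simp
    qed
    hence "sqrt ((1 - y) / (x - 1)) < sqrt (l1\<^sup>2)" by (simp only: real_sqrt_less_iff)
    thus "sqrt ((1 - y) / (x - 1)) < l1" using l1pos by simp
    have "l1 * (2 - x) / (2 - y) = m" using j by (simp add: l1_def)
    thus "mob_T (rot_mat j) (lift j x y l1) = crossing j (1 / (2 - x)) (1 / (2 - y))"
      using j l1pos by (simp add: mob_T_rot_lift_lt_2 crossing_def m_def)
    fix l assume l: "sqrt ((1 - y) / (x - 1)) < l" "l < l1"
    note gt = height_gt[OF j(2,4) l(1)]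
    have "l\<^sup>2 < l1\<^sup>2" using l gt by (intro power_strict_mono) auto
    hence "(x - 1) * (2 - x) * l\<^sup>2 < (1 - y) * (2 - y)"
      unfolding l12 using j by (subst (asm) pos_less_divide_eq) (simp_all add: mult_ac)
    hence "(x - 1) * (x - 2) * l\<^sup>2 + (1 - y) * (2 - y) > 0" by (simp add: algebra_simps)
    moreover have "(x - 3) * l\<^sup>2 \<le> 0" using j by (simp add: mult_nonpos_nonneg)
    moreover have "(x - 2) * (x - 3) > 0" using j by (simp add: mult_neg_neg)
    hence "(x - 2) * (x - 3) * l\<^sup>2 + (2 - y) * (3 - y) > 0"
      using gt j by (intro add_pos_pos mult_pos_pos[of _ "l\<^sup>2"]) auto
    ultimately show "proj_T (lift j x y l) \<notin> section_M" using gt j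
      by (intro lift_not_in_section) auto
  qed (use j rot_mat_in_theta in auto)
qed

section \<open>Geodesics running into a cusp of the current tile\<close>

lemma eventually_exp_gt:
  assumes "l > 0"
  shows "\<forall>\<^sub>F t in at_top. K < l * exp (t::real)"
proof -
  have "filterlim (\<lambda>t. l * exp t) at_top at_top"
    by (rule filterlim_tendsto_pos_mult_at_top[OF tendsto_const assms exp_at_top])
  thus ?thesis by (simp add: filterlim_at_top_dense)
qed

text \<open>For x = 2 or x = 3 all four tile inequalities persist for every later height, so the
  tile is never left. The bound h (3 - y) is the one required at the cusp 3 and also suffices at 2,
  where h (2 - y) would do.\<close>

lemma lost_crossing:
  assumes j: "\<bar>j\<bar> = 1" "y < 1" and x: "x = 2 \<or> x = 3"
    and cusp: "is_cusp b" and B: "B \<in> theta_group"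
    and h: "\<And>h l. h > 0 \<Longrightarrow> l > h * (3 - y) \<Longrightarrow> fst (mob_T B (lift j x y l)) \<in> horoball b h"
  shows "lost (crossing j x y)"
proof -
  have x1: "1 < x" using x by auto
  have yx: "y < x" using j x1 by simp
  define l0 where "l0 = sqrt ((1 - y) / (x - 1))"
  have l0: "l0 > 0" using j x1 by (simp add: l0_def)
  have flow: "flow_H t (crossing j x y) = lift j x y (l0 * exp t)" for t
    unfolding crossing_def l0_def[symmetric] by (rule flow_H_lift) fact+
  have T1: "lift j x y (l0 * exp t) \<in> T1H" for t using l0 j yx by (intro lift_in_T1H) auto
  have "proj_T (flow_H t (crossing j x y)) \<notin> section_M" if "t > 0" for t
  proof -
    have "l0 < l0 * exp t" using l0 that by simp
    note gt = height_gt[OF x1 j(2) this[unfolded l0_def]]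
    show ?thesis unfolding flow l0_def using gt j x x1
      by (intro lift_not_in_section) (auto intro: add_nonneg_pos mult_pos_pos)
  qed
  moreover have proj: "proj_H (fst (lift j x y (l0 * exp t))) = proj_H (fst (mob_T B (lift j x y (l0 * exp t))))" for t
    unfolding fst_mob_T by (rule proj_H_mob[OF B, symmetric]) (rule Im_fst_T1H[OF T1])
  have "\<forall>\<^sub>F t in at_top. proj_H (fst (flow_H t (crossing j x y))) \<in> proj_H ` horoball b h" if "h > 0" for h
    unfolding flow using eventually_exp_gt[OF l0, of "h * (3 - y)"]
    by eventually_elim (use assms(6)[OF that] proj in auto)
  ultimately show ?thesis
    unfolding lost_def using crossing_in_T1H[OF j(1) x1 j(2)] cusp escapes_to_cusp_proj_T by blast
qed

lemma is_cusp_Infty: "is_cusp Infty_pt"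
proof -
  have "tau \<in> theta_group" "\<bar>trace tau\<bar> = 2" "tau \<noteq> mat 1" "tau \<noteq> - mat 1" "mob_bdry tau Infty_pt = Infty_pt"
    by (simp_all add: tau_int_mat int_mat_in_theta trace_def sum_2 mat_1_int_mat imat_eq_iff)
  thus ?thesis unfolding is_cusp_def by blast
qed

lemma is_cusp_sign:
  assumes "\<bar>j\<bar> = 1"
  shows "is_cusp (Real_pt (of_int j))"
proof -
  \<comment> \<open>A parabolic element: its fixed point equation is (z - j)^2 = 0.\<close>
  let ?A = "int_mat 0 1 (-1) (2 * j)"
  have "?A \<in> theta_group" "\<bar>trace ?A\<bar> = 2" "?A \<noteq> mat 1" "?A \<noteq> - mat 1" "mob_bdry ?A (Real_pt (of_int j)) = Real_pt (of_int j)"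
    using sign_cases[OF assms] by (auto simp: int_mat_in_theta trace_def sum_2 mat_1_int_mat imat_eq_iff)
  thus ?thesis unfolding is_cusp_def by blast
qed

text \<open>\<open>rot_mat j\<close> sends the cusp 2 j to infinity and makes the geodesic vertical;
  its height there is l / (2 - y).\<close>

lemma lost_2:
  assumes j: "\<bar>j\<bar> = 1" "y < 1"
  shows "lost (crossing j 2 y)"
proof (rule lost_crossing[OF j _ is_cusp_Infty rot_mat_in_theta])
  fix h l :: real assume h: "h > 0" "l > h * (3 - y)"
  hence l: "l > 0" using j by (smt (verit) mult_pos_pos)
  have "(cmod (of_real 0 * \<i> + of_real (of_int j * (y - 2))))\<^sup>2 = (2 - y)\<^sup>2"
  proof -
    have "(cmod (of_real 0 * \<i> + of_real (of_int j * (y - 2))))\<^sup>2 = (of_int j * (y - 2))\<^sup>2"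
      by (simp del: of_real_mult)
    also have "\<dots> = (of_int j * of_int j) * (2 - y)\<^sup>2"
      by (simp add: power2_eq_square algebra_simps)
    finally show ?thesis unfolding sign_square[OF j(1)] by simp
  qed
  note norm = this
  have "fst (mob_T (rot_mat j) (lift j 2 y l)) = real_mob (- (of_int j * l)) (-1) 0 (of_int j * (y - 2)) \<i>"
    using j l by (simp add: mob_T_rot_lift tangent_def)
  moreover have "- (of_int j * l) * (of_int j * (y - 2)) - (-1) * 0 = l * (2 - y)"
    unfolding mult_minus_left sign_cancel[OF j(1)] by (simp add: algebra_simps)
  ultimately have "Im (fst (mob_T (rot_mat j) (lift j 2 y l))) = l * (2 - y) * Im \<i> / (2 - y)\<^sup>2"
    by (simp only: Im_real_mob norm)
  hence "Im (fst (mob_T (rot_mat j) (lift j 2 y l))) = l / (2 - y)"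
    using j by (simp add: power2_eq_square)
  moreover have "h < l / (2 - y)"
  proof -
    have "h * (2 - y) \<le> h * (3 - y)" using h by (intro mult_left_mono) auto
    thus ?thesis using h j by (simp add: field_simps)
  qed
  ultimately show "fst (mob_T (rot_mat j) (lift j 2 y l)) \<in> horoball Infty_pt h"
    by (simp add: horoball_def)
qed simp

text \<open>\<open>trans_mat j\<close> sends the cusp 3 j to j. Along the image Im z / |z - j|^2 = l
  / (3 - y), the quantity that the horoballs at j bound from below.\<close>

lemma lost_3:
  assumes j: "\<bar>j\<bar> = 1" "y < 1"
  shows "lost (crossing j 3 y)"
proof (rule lost_crossing[OF j _ is_cusp_sign[OF j(1)] trans_mat_in_theta])
  fix h l :: real assume h: "h > 0" "l > h * (3 - y)"
  hence l: "l > 0" using j by (smt (verit) mult_pos_pos)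
  let ?z = "fst (lift j 1 (y - 2) l)"
  have pos: "l\<^sup>2 + 1 > 0" by (simp add: add_nonneg_pos)
  have "(cmod (?z - of_real (of_int j)))\<^sup>2 = (cmod ?z)\<^sup>2 - 2 * (of_int j * Re ?z) + (of_int j * of_int j)"
    unfolding cmod_power2 by (simp add: power2_eq_square algebra_simps)
  also have "\<dots> = (l\<^sup>2 + (y - 2)\<^sup>2) / (l\<^sup>2 + 1) - 2 * ((l\<^sup>2 + (y - 2)) / (l\<^sup>2 + 1)) + (l\<^sup>2 + 1) / (l\<^sup>2 + 1)"
    unfolding cmod_lift[OF j(1)] Re_lift[OF j(1)] sign_square[OF j(1)] sign_square'[OF j(1)] using pos by simp
  also have "\<dots> = (3 - y)\<^sup>2 / (l\<^sup>2 + 1)"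
    unfolding times_divide_eq_right diff_divide_distrib[symmetric] add_divide_distrib[symmetric]
    by (simp add: power2_eq_square algebra_simps)
  finally have "h * (cmod (?z - of_real (of_int j)))\<^sup>2 = (h * (3 - y)) * (3 - y) / (l\<^sup>2 + 1)"
    by (simp add: power2_eq_square)
  also have "\<dots> < l * (3 - y) / (l\<^sup>2 + 1)"
    using h j pos by (intro divide_strict_right_mono mult_strict_right_mono) auto
  also have "\<dots> = Im ?z" unfolding Im_lift[OF j(1)] by (simp add: algebra_simps)
  finally have "?z \<in> horoball (Real_pt (of_int j)) h" by (simp add: horoball_def)
  thus "fst (mob_T (trans_mat j) (lift j 3 y l)) \<in> horoball (Real_pt (of_int j)) h"
    using j l by (simp add: mob_T_trans_lift)
qed simp


section \<open>The first return\<close>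

lemma matrix_inv_eqI:
  fixes A B :: imat
  assumes "A ** B = mat 1" "B ** A = mat 1"
  shows "matrix_inv A = B"
proof -
  have "A ** matrix_inv A = mat 1 \<and> matrix_inv A ** A = mat 1"
    unfolding matrix_inv_def by (rule someI[of _ B]) (use assms in simp)
  hence "matrix_inv A = matrix_inv A ** (A ** B)" "matrix_inv A ** A = mat 1" using assms by simp_all
  thus ?thesis by (simp add: matrix_mul_assoc)
qed

lemma matrix_inv_tau: "matrix_inv tau = int_mat 1 (-2) 0 1"
  by (rule matrix_inv_eqI) (simp_all add: tau_int_mat int_mat_mult mat_1_int_mat)

lemma funpow_shift: "(((**) (int_mat 1 a 0 1)) ^^ n) (mat 1) = int_mat 1 (a * int n) 0 1"
  by (induction n) (simp_all add: mat_1_int_mat int_mat_mult algebra_simps)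

lemma mat_powi_tau: "mat_powi tau n = int_mat 1 (2 * n) 0 1"
  unfolding mat_powi_def matrix_inv_tau by (simp add: tau_int_mat funpow_shift)

lemma mat_powi_nat: "mat_powi A (int n) = (((**) A) ^^ n) (mat 1)"
  by (simp add: mat_powi_def)

lemma mat_powi_0: "mat_powi A 0 = mat 1"
  by (simp add: mat_powi_def)

text \<open>The iteration adds factors on the left, whereas the inductions below split off the first
  move, which is the rightmost factor.\<close>

lemma mat_powi_Suc: "mat_powi A (int (Suc n)) = mat_powi A (int n) ** A"
proof -
  have "A ** (((**) A) ^^ n) (mat 1) = (((**) A) ^^ n) (mat 1) ** A"
    by (induction n) (simp_all add: matrix_mul_assoc)
  thus ?thesis unfolding mat_powi_nat by simp
qed

lemma trans_mat_eq: "mat_powi tau (- j) = trans_mat j"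
  by (simp add: mat_powi_tau trans_mat_def)

lemma rot_mat_eq: "sigma ** mat_powi tau (- j) = rot_mat j"
  by (simp add: mat_powi_tau rot_mat_def sigma_int_mat int_mat_mult)

lemma sigma_tau_pow_step:
  "(sigma ** mat_powi tau (- j * int k)) ** trans_mat j = sigma ** mat_powi tau (- j * int (Suc k))"
  by (simp add: mat_powi_tau trans_mat_def sigma_int_mat int_mat_mult algebra_simps)

section \<open>Backward endpoints below, inside and above the interval\<close>

lemma sqrt3_norm: "(2 - sqrt 3) * (2 + sqrt 3) = 1"
  by (simp add: algebra_simps)

text \<open>Leaving through the side over [2, 3] is always a return: the value lies in (-1, 0), well
  inside the interval.\<close>

lemma recip_neg_in_back_interval: "y < 1 \<Longrightarrow> 1 / (y - 2) \<in> back_interval"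
proof -
  assume "y < 1"
  hence "-1 < 1 / (y - 2)" "1 / (y - 2) < 0" by (simp_all add: field_simps)
  thus ?thesis using sqrt3 unfolding back_interval_def atLeastLessThan_iff by linarith
qed

lemma recip_in_back_interval: "y < - sqrt 3 \<Longrightarrow> 1 / (2 - y) \<in> back_interval"
proof -
  assume y: "y < - sqrt 3"
  have "1 < (2 - sqrt 3) * (2 - y)"
    unfolding sqrt3_norm[symmetric] using y sqrt3 by (intro mult_strict_left_mono) auto
  moreover have "2 - y > 0" using y sqrt3 by linarith
  ultimately have "1 / (2 - y) < 2 - sqrt 3" "1 / (2 - y) > 0" by (simp_all add: field_simps)
  thus ?thesis using sqrt3 unfolding back_interval_def atLeastLessThan_iff by linarith
qed

lemma recip_above_back_interval:
  assumes "- sqrt 3 \<le> y" "y < 1"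
  shows "2 - sqrt 3 \<le> 1 / (2 - y)" "1 / (2 - y) < 1" "- sqrt 3 \<le> 1 / (2 - y)" "1 / (2 - y) \<notin> back_interval"
proof -
  have "(2 - sqrt 3) * (2 - y) \<le> 1"
    unfolding sqrt3_norm[symmetric] using assms sqrt3 by (intro mult_left_mono) auto
  thus *: "2 - sqrt 3 \<le> 1 / (2 - y)" using assms by (simp add: field_simps)
  show "1 / (2 - y) < 1" using assms by simp
  show "- sqrt 3 \<le> 1 / (2 - y)" using * by linarith
  show "1 / (2 - y) \<notin> back_interval" using * by (simp add: back_interval_def)
qed

lemma shift_below_back_interval: "y < 2 - sqrt 3 \<Longrightarrow> y - 2 \<notin> back_interval"
  by (simp add: back_interval_def)

lemma crossing_in_X_set: "\<bar>j\<bar> = 1 \<Longrightarrow> 1 < x \<Longrightarrow> y \<in> back_interval \<Longrightarrow> crossing j x y \<in> X_set"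
  using X_set_iff by blast

section \<open>Runs of equal moves up to the return or the cusp\<close>

definition reaches :: "tvec \<Rightarrow> imat \<Rightarrow> bool" where
  "reaches v B \<longleftrightarrow> (\<exists>w\<in>X_set. moves_to v B w)"

lemma reaches_step:
  assumes "moves_to v B (crossing j x y)" "\<bar>j\<bar> = 1" "1 < x" "y < 1" "y \<notin> back_interval" "reaches (crossing j x y) B'"
  shows "reaches v (B' ** B)"
  using assms moves_to_trans proj_T_crossing_in_section_iff unfolding reaches_def by blast

lemma lost_crossing_step:
  assumes "moves_to v B (crossing j x y)" "\<bar>j\<bar> = 1" "1 < x" "y < 1" "y \<notin> back_interval" "lost (crossing j x y)"
  shows "lost v"
  using assms lost_step proj_T_crossing_in_section_iff by blast

text \<open>After k - 1 translations 2 < x < 3, and the rotation returns from any position. The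
  invariant y < 2 - sqrt 3, inside or below, makes each translation land strictly below the
  interval, hence off the section.\<close>

lemma reaches_above_even:
  assumes j: "\<bar>j\<bar> = 1" and "k \<ge> 1" "2 * real k < x" "x < 2 * real k + 1" "y < 2 - sqrt 3"
  shows "reaches (crossing j x y) (sigma ** mat_powi tau (- j * int k))"
  using assms(2-)
proof (induction k arbitrary: x y rule: nat_induct_at_least)
  case base
  have "y < 1" using base sqrt3 by linarith
  with base have *: "2 < x" "x < 3" "y < 1" by auto
  have "crossing (- j) (1 / (x - 2)) (1 / (y - 2)) \<in> X_set"
    using * j recip_neg_in_back_interval by (intro crossing_in_X_set) auto
  thus ?case using moves_to_between_2_3[OF j *] by (auto simp: reaches_def rot_mat_eq)
next
  case (Suc k)
  have y: "y < 1" using Suc.prems sqrt3 by linarith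
  have x: "3 < x" using Suc by simp
  show ?case unfolding sigma_tau_pow_step[symmetric]
  proof (rule reaches_step[OF moves_to_gt_3[OF j x y] j])
    show "reaches (crossing j (x - 2) (y - 2)) (sigma ** mat_powi tau (- j * int k))"
      by (rule Suc.IH) (use Suc.prems in auto)
  qed (use x y Suc.prems shift_below_back_interval in auto)
qed

text \<open>After k - 1 translations 1 < x < 2, where the rotation returns if y has got strictly
  below the interval. The last hypothesis states this for the translated y; its force is at k = 1,
  where the induction ends.\<close>

lemma reaches_below_even:
  assumes j: "\<bar>j\<bar> = 1" and "k \<ge> 1" "2 * real k - 1 < x" "x < 2 * real k" "y < 2 - sqrt 3"
    "y < 2 * real k - 2 - sqrt 3"
  shows "reaches (crossing j x y) (sigma ** mat_powi tau (- j * int k))"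
  using assms(2-)
proof (induction k arbitrary: x y rule: nat_induct_at_least)
  case base
  hence y: "y < - sqrt 3" by simp
  hence "y < 1" using sqrt3 by linarith
  with base have *: "1 < x" "x < 2" "y < 1" by auto
  have "crossing j (1 / (2 - x)) (1 / (2 - y)) \<in> X_set"
    using * j recip_in_back_interval[OF y] by (intro crossing_in_X_set) auto
  thus ?case using moves_to_lt_2[OF j *] by (auto simp: reaches_def rot_mat_eq)
next
  case (Suc k)
  have y: "y < 1" using Suc.prems sqrt3 by linarith
  have x: "3 < x" using Suc by simp
  show ?case unfolding sigma_tau_pow_step[symmetric]
  proof (rule reaches_step[OF moves_to_gt_3[OF j x y] j])
    show "reaches (crossing j (x - 2) (y - 2)) (sigma ** mat_powi tau (- j * int k))"
      by (rule Suc.IH) (use Suc.prems in auto)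
  qed (use x y Suc.prems shift_below_back_interval in auto)
qed

text \<open>In terms of s = 2 / (x - 1) the bounds say 2 k - 2 < s < 2 k - 1, and each rotation
  lowers s by 2 and k by 1. Cleared of denominators they also make sense at k = 1, where they say x
  > 3. The translation performed there returns from above the interval, whence the last hypothesis;
  any preceding rotation supplies it.\<close>

lemma reaches_below_cusp:
  assumes j: "\<bar>j\<bar> = 1" and "k \<ge> 1" "1 < x" "2 * real k + 1 < (2 * real k - 1) * x" "(real k - 1) * x < real k"
    "- sqrt 3 \<le> y" "y < 1" "k = 1 \<Longrightarrow> 2 - sqrt 3 \<le> y"
  shows "reaches (crossing j x y) (trans_mat j ** mat_powi (rot_mat j) (int (k - 1)))"
  using assms(2-)
proof (induction k arbitrary: x y rule: nat_induct_at_least)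
  case base
  have "y - 2 \<in> back_interval" using base sqrt3 unfolding back_interval_def atLeastLessThan_iff by auto
  hence "crossing j (x - 2) (y - 2) \<in> X_set" using base j by (intro crossing_in_X_set) auto
  thus ?case using moves_to_gt_3[OF j, of x y] base by (auto simp: reaches_def mat_powi_0)
next
  case (Suc k)
  have x2: "x < 2"
  proof (rule ccontr)
    assume "\<not> x < 2"
    hence "real k * 2 \<le> real k * x" by (intro mult_left_mono) auto
    moreover have "real k * x < real k + 1" using Suc.prems(3) by simp
    ultimately show False using Suc.hyps by linarith
  qed
  note y = recip_above_back_interval[OF Suc.prems(4,5)]
  have "trans_mat j ** mat_powi (rot_mat j) (int (Suc k - 1)) = (trans_mat j ** mat_powi (rot_mat j) (int (k - 1))) ** rot_mat j"
    using mat_powi_Suc[of "rot_mat j" "k - 1"] Suc.hyps by (simp add: matrix_mul_assoc)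
  moreover have "reaches (crossing j x y) \<dots>"
  proof (rule reaches_step[OF moves_to_lt_2[OF j Suc.prems(1) x2 Suc.prems(5)] j])
    show "reaches (crossing j (1 / (2 - x)) (1 / (2 - y))) (trans_mat j ** mat_powi (rot_mat j) (int (k - 1)))"
      by (rule Suc.IH) (use Suc.prems x2 y in \<open>auto simp: field_simps\<close>)
  qed (use Suc.prems x2 y in auto)
  ultimately show ?case by simp
qed

text \<open>Here 2 k - 1 < s < 2 k. Rotations lower s by 2 until 2 < x < 3, and the next rotation
  returns from any y.\<close>

lemma reaches_above_cusp:
  assumes j: "\<bar>j\<bar> = 1" and "k \<ge> 1" "real k + 1 < real k * x" "(2 * real k - 1) * x < 2 * real k + 1"
    "- sqrt 3 \<le> y" "y < 1"
  shows "reaches (crossing j x y) (mat_powi (rot_mat j) (int k))"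
  using assms(2-)
proof (induction k arbitrary: x y rule: nat_induct_at_least)
  case base
  hence "crossing (- j) (1 / (x - 2)) (1 / (y - 2)) \<in> X_set"
    using j recip_neg_in_back_interval by (intro crossing_in_X_set) auto
  thus ?case using moves_to_between_2_3[OF j, of x y] base mat_powi_Suc[of "rot_mat j" 0]
    by (auto simp: reaches_def mat_powi_0)
next
  case (Suc k)
  have x1: "1 < x"
  proof (rule ccontr)
    assume "\<not> 1 < x"
    hence "real (Suc k) * x \<le> real (Suc k) * 1" by (intro mult_left_mono) auto
    from order.strict_trans2[OF Suc.prems(1) this] show False by simp
  qed
  have x2: "x < 2"
  proof (rule ccontr)
    assume "\<not> x < 2"
    hence "(2 * real (Suc k) - 1) * 2 \<le> (2 * real (Suc k) - 1) * x" by (intro mult_left_mono) auto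
    from order.strict_trans1[OF this Suc.prems(2)] show False using Suc.hyps by simp
  qed
  note y = recip_above_back_interval[OF Suc.prems(3,4)]
  show ?case unfolding mat_powi_Suc
  proof (rule reaches_step[OF moves_to_lt_2[OF j x1 x2 Suc.prems(4)] j])
    show "reaches (crossing j (1 / (2 - x)) (1 / (2 - y))) (mat_powi (rot_mat j) (int k))"
      by (rule Suc.IH) (use Suc.prems x2 y in \<open>auto simp: field_simps\<close>)
  qed (use x1 Suc.prems x2 y in auto)
qed

text \<open>Translations by 2 end at the cusp 2 or 3 according to parity, staying below the interval
  all the way.\<close>

lemma lost_integer:
  assumes j: "\<bar>j\<bar> = 1" and "n \<ge> 2" "y < 2 - sqrt 3"
  shows "lost (crossing j (real n) y)"
  using assms(2-)
proof (induction n arbitrary: y rule: less_induct)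
  case (less n)
  have y: "y < 1" using less.prems sqrt3 by linarith
  consider "n = 2" | "n = 3" | "n > 3" using less.prems by linarith
  thus ?case
  proof cases
    case 3
    have "lost (crossing j (real (n - 2)) (y - 2))"
      by (rule less.IH) (use 3 less.prems in auto)
    hence "lost (crossing j (real n - 2) (y - 2))" using 3 by (simp add: of_nat_diff)
    thus ?thesis
      using lost_crossing_step[OF moves_to_gt_3[OF j _ y, of "real n"] j] 3 y less.prems shift_below_back_interval by simp
  qed (use lost_2[OF j y] lost_3[OF j y] in simp_all)
qed

text \<open>Here s = 2 k - 2, and rotations bring it down to s = 2, that is x = 2, with every
  intermediate crossing above the interval.\<close>

lemma lost_even_cusp:
  assumes j: "\<bar>j\<bar> = 1" and "k \<ge> 2" "(real k - 1) * x = real k" "- sqrt 3 \<le> y" "y < 1"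
  shows "lost (crossing j x y)"
  using assms(2-)
proof (induction k arbitrary: x y rule: nat_induct_at_least)
  case base
  thus ?case using lost_2[OF j] by simp
next
  case (Suc k)
  have x: "x = 1 + 1 / real k" using Suc by (simp add: field_simps)
  have x1: "1 < x" "x < 2" using Suc.hyps unfolding x by auto
  note y = recip_above_back_interval[OF Suc.prems(2,3)]
  show ?case
  proof (rule lost_crossing_step[OF moves_to_lt_2[OF j x1 Suc.prems(3)] j])
    show "lost (crossing j (1 / (2 - x)) (1 / (2 - y)))"
      by (rule Suc.IH) (use Suc.prems x1 y in \<open>auto simp: field_simps\<close>)
  qed (use x1 Suc.prems y in auto)
qed

text \<open>Here s = 2 k - 1, which comes down to s = 1, that is x = 3. This end value is k = 1, one
  below the range of k in \<open>E_set\<close>.\<close>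

lemma lost_odd_cusp:
  assumes j: "\<bar>j\<bar> = 1" and "k \<ge> 1" "(2 * real k - 1) * x = 2 * real k + 1" "- sqrt 3 \<le> y" "y < 1"
  shows "lost (crossing j x y)"
  using assms(2-)
proof (induction k arbitrary: x y rule: nat_induct_at_least)
  case base
  thus ?case using lost_3[OF j] by simp
next
  case (Suc k)
  have x: "x = 1 + 2 / (2 * real k + 1)" using Suc by (simp add: field_simps)
  have x1: "1 < x" "x < 2" using Suc.hyps unfolding x by (auto simp: field_simps)
  note y = recip_above_back_interval[OF Suc.prems(2,3)]
  show ?case
  proof (rule lost_crossing_step[OF moves_to_lt_2[OF j x1 Suc.prems(3)] j])
    show "lost (crossing j (1 / (2 - x)) (1 / (2 - y)))"
      by (rule Suc.IH) (use Suc.prems x1 y in \<open>auto simp: field_simps\<close>)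
  qed (use x1 Suc.prems y in auto)
qed

section \<open>Comparison of the first return with \<open>rho\<close>\<close>

lemma first_return_eqI:
  assumes "moves_to v B w" "v \<in> X_set" "w \<in> X_set"
  shows "first_return (proj_T v) = Some (proj_T w)"
proof -
  obtain t where v: "v \<in> T1H" and B: "B \<in> theta_group" and t: "t > 0" "mob_T B (flow_H t v) = w"
    and nt: "\<And>s. 0 < s \<Longrightarrow> s < t \<Longrightarrow> proj_T (flow_H s v) \<notin> section_M"
    using assms(1) unfolding moves_to_def by blast
  have flow: "flow_M t (proj_T v) = proj_T w"
    using flow_M_proj_T[OF v] proj_T_mob_T[OF B flow_H_in_T1H[OF v]] t(2) by metis
  have first: "is_first_return_time (proj_T v) t"
    unfolding is_first_return_time_def flow using t(1) assms(3) nt flow_M_proj_T[OF v]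
    by (auto simp: not_le[symmetric])
  have "(THE t. is_first_return_time (proj_T v) t) = t"
    by (rule the_equality[where P = "is_first_return_time (proj_T v)", OF first]) (use first in \<open>auto simp: is_first_return_time_def intro: antisym\<close>)
  thus ?thesis using first assms(2) flow by (auto simp: first_return_def)
qed

lemma geodesic_of_vec_moves_to:
  assumes "moves_to v B w"
  shows "geodesic_of_vec w = mob_geodesic B (geodesic_of_vec v)"
  using assms geodesic_of_vec_mob_T geodesic_of_vec_flow_H flow_H_in_T1H unfolding moves_to_def by metis

lemma fwd_real_crossing:
  assumes "\<bar>j\<bar> = 1" "1 < x" "y < 1"
  shows "\<bar>fwd_real (geodesic_of_vec (crossing j x y))\<bar> = x" "j_sgn (geodesic_of_vec (crossing j x y)) = j"
  using ends_crossing[OF assms] sign_cases[OF assms(1)] assms(2) floor_of_int[of "-1", where 'a = real]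
  by (auto simp: j_sgn_def)

lemma rho_rel_reaches:
  assumes j: "\<bar>j\<bar> = 1" "1 < x" "y \<in> back_interval"
    and rel: "rho_rel (geodesic_of_vec (crossing j x y)) \<gamma>'"
  shows "\<exists>B. reaches (crossing j x y) B \<and> \<gamma>' = mob_geodesic B (geodesic_of_vec (crossing j x y))"
proof -
  note y = back_interval_lt_1[OF j(3)]
  have y': "- sqrt 3 \<le> y" "y < 2 - sqrt 3" using j(3) by (auto simp: back_interval_def)
  let ?\<gamma> = "geodesic_of_vec (crossing j x y)"
  from rel obtain k :: int where k:
    "(1 \<le> k \<and> x \<in> {2 * of_int k<..<2 * of_int k + 1} \<and> \<gamma>' = mob_geodesic (sigma ** mat_powi tau (- j * k)) ?\<gamma>) \<or>
     (2 \<le> k \<and> x \<in> {2 * of_int k - 1<..<2 * of_int k} \<and> \<gamma>' = mob_geodesic (sigma ** mat_powi tau (- j * k)) ?\<gamma>) \<or>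
     (2 \<le> k \<and> x \<in> {(2 * of_int k + 1) / (2 * of_int k - 1)<..<of_int k / (of_int k - 1)} \<and>
        \<gamma>' = mob_geodesic (trans_mat j ** mat_powi (rot_mat j) (k - 1)) ?\<gamma>) \<or>
     (2 \<le> k \<and> x \<in> {(of_int k + 1) / of_int k<..<(2 * of_int k + 1) / (2 * of_int k - 1)} \<and>
        \<gamma>' = mob_geodesic (mat_powi (rot_mat j) k) ?\<gamma>)"
    unfolding rho_rel_def Let_def fwd_real_crossing[OF j(1,2) y] rot_mat_eq
    unfolding trans_mat_eq by (elim exE)
  hence "k \<ge> 1" by auto
  define n where "n = nat k"
  have n: "k = int n" "n \<ge> 1" using \<open>k \<ge> 1\<close> by (simp_all add: n_def)
  from k[unfolded n(1)] show ?thesis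
  proof (elim disjE conjE)
    assume "x \<in> {2 * of_int (int n)<..<2 * of_int (int n) + 1}" "\<gamma>' = mob_geodesic (sigma ** mat_powi tau (- j * int n)) ?\<gamma>"
    thus ?thesis using reaches_above_even[OF j(1) n(2) _ _ y'(2), of x] by auto
  next
    assume "2 \<le> int n" "x \<in> {2 * of_int (int n) - 1<..<2 * of_int (int n)}" "\<gamma>' = mob_geodesic (sigma ** mat_powi tau (- j * int n)) ?\<gamma>"
    thus ?thesis using reaches_below_even[OF j(1) n(2) _ _ y'(2), of x] y' by auto
  next
    assume *: "2 \<le> int n" "x \<in> {(2 * of_int (int n) + 1) / (2 * of_int (int n) - 1)<..<of_int (int n) / (of_int (int n) - 1)}"
      "\<gamma>' = mob_geodesic (trans_mat j ** mat_powi (rot_mat j) (int n - 1)) ?\<gamma>"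
    have "2 * real n + 1 < (2 * real n - 1) * x" "(real n - 1) * x < real n" "int n - 1 = int (n - 1)"
      using *(1,2) by (auto simp: field_simps of_nat_diff)
    thus ?thesis using reaches_below_cusp[OF j(1) n(2) j(2) _ _ y'(1) y] * by auto
  next
    assume *: "2 \<le> int n" "x \<in> {(of_int (int n) + 1) / of_int (int n)<..<(2 * of_int (int n) + 1) / (2 * of_int (int n) - 1)}"
      "\<gamma>' = mob_geodesic (mat_powi (rot_mat j) (int n)) ?\<gamma>"
    have "real n + 1 < real n * x" "(2 * real n - 1) * x < 2 * real n + 1"
      using *(1,2) by (auto simp: field_simps)
    thus ?thesis using reaches_above_cusp[OF j(1) n(2) _ _ y'(1) y] * by auto
  qed
qed

lemma E_set_complement_cases:
  assumes "1 < x" "x \<notin> E_set"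
  obtains k :: int where "1 \<le> k" "x \<in> {2 * of_int k<..<2 * of_int k + 1}"
  | k :: int where "2 \<le> k" "x \<in> {2 * of_int k - 1<..<2 * of_int k}"
  | k :: int where "2 \<le> k" "x \<in> {(2 * of_int k + 1) / (2 * of_int k - 1)<..<of_int k / (of_int k - 1)}"
  | k :: int where "2 \<le> k" "x \<in> {(of_int k + 1) / of_int k<..<(2 * of_int k + 1) / (2 * of_int k - 1)}"
proof -
  have E: "x \<noteq> of_int k / (of_int k - 1)" "x \<noteq> (2 * of_int k + 1) / (2 * of_int k - 1)" "x \<noteq> of_int k"
    if "k \<ge> 2" for k :: int using assms(2) that unfolding E_set_def by auto
  have "x \<noteq> 2" using E(3)[of 2] by simp
  show thesis
  proof (cases "x > 2")
    case True
    define n where "n = \<lfloor>x\<rfloor>"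
    have n: "of_int n \<le> x" "x < of_int n + 1" unfolding n_def by linarith+
    have "n \<ge> 2" using True unfolding n_def by linarith
    hence lt: "of_int n < x" using n E(3)[of n] by fastforce
    show thesis
    proof (cases "even n")
      case True
      then obtain k where "n = 2 * k" by blast
      thus thesis using that(1)[of k] \<open>n \<ge> 2\<close> lt n by simp
    next
      case False
      then obtain k where "n = 2 * k + 1" by (elim oddE)
      thus thesis using that(2)[of "k + 1"] \<open>n \<ge> 2\<close> lt n by simp
    qed
  next
    case False
    hence x: "x < 2" using \<open>x \<noteq> 2\<close> by simp
    \<comment> \<open>The points of \<open>E_set\<close> in (1, 2) are those with s an integer above
      2: s = 2 m gives (m + 1)/m and s = 2 m + 1 gives (2 m + 3)/(2 m + 1). So the parity of the
      floor of s selects the case, with k = m + 1.\<close>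
    define s where "s = 2 / (x - 1)"
    have s: "s > 2" and xs: "x = 1 + 2 / s" using x assms(1) by (auto simp: s_def field_simps)
    define n where "n = \<lfloor>s\<rfloor>"
    have n: "of_int n \<le> s" "s < of_int n + 1" unfolding n_def by linarith+
    have n2: "n \<ge> 2" using s unfolding n_def by linarith
    show thesis
    proof (cases "even n")
      case True
      then obtain m where m: "n = 2 * m" by blast
      have "s \<noteq> of_int n"
      proof
        assume "s = of_int n"
        hence "x = of_int (m + 1) / (of_int (m + 1) - 1)" using xs m n2 by (simp add: field_simps)
        thus False using E(1)[of "m + 1"] m n2 by simp
      qed
      hence "of_int n < s" using n by simp
      hence "x < of_int (m + 1) / (of_int (m + 1) - 1)" "(2 * of_int (m + 1) + 1) / (2 * of_int (m + 1) - 1) < x"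
        unfolding xs using m n n2 s by (simp_all add: field_simps)
      thus thesis using that(3)[of "m + 1"] m n2 by simp
    next
      case False
      then obtain m where m: "n = 2 * m + 1" by (elim oddE)
      have "s \<noteq> of_int n"
      proof
        assume "s = of_int n"
        hence "x = (2 * of_int (m + 1) + 1) / (2 * of_int (m + 1) - 1)" using xs m n2 by (simp add: field_simps)
        thus False using E(2)[of "m + 1"] m n2 by simp
      qed
      hence "of_int n < s" using n by simp
      hence "x < (2 * of_int (m + 1) + 1) / (2 * of_int (m + 1) - 1)" "(of_int (m + 1) + 1) / of_int (m + 1) < x"
        unfolding xs using m n n2 s by (simp_all add: field_simps)
      thus thesis using that(4)[of "m + 1"] m n2 by simp
    qed
  qed
qed

lemma ex_rho_rel:
  assumes j: "\<bar>j\<bar> = 1" "1 < x" "y < 1" "x \<notin> E_set"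
  shows "\<exists>\<gamma>'. rho_rel (geodesic_of_vec (crossing j x y)) \<gamma>'"
  unfolding rho_rel_def Let_def fwd_real_crossing[OF j(1-3)]
  by (rule E_set_complement_cases[OF j(2,4)]) blast+

lemma rho_eq_first_return:
  assumes j: "\<bar>j\<bar> = 1" "1 < x" "y \<in> back_interval" "x \<notin> E_set"
  shows "\<exists>w\<in>X_set. first_return (proj_T (crossing j x y)) = Some (proj_T w) \<and>
    rho (geodesic_of_vec (crossing j x y)) = geodesic_of_vec w"
proof -
  let ?v = "crossing j x y" and ?\<gamma> = "geodesic_of_vec (crossing j x y)"
  have v: "?v \<in> X_set" using j crossing_in_X_set by blast
  have *: "\<exists>w\<in>X_set. first_return (proj_T ?v) = Some (proj_T w) \<and> \<gamma>' = geodesic_of_vec w"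
    if "rho_rel ?\<gamma> \<gamma>'" for \<gamma>'
    using rho_rel_reaches[OF j(1-3) that] v first_return_eqI geodesic_of_vec_moves_to
    unfolding reaches_def by metis
  obtain \<gamma>' where rel: "rho_rel ?\<gamma> \<gamma>'" using ex_rho_rel[OF j(1,2) back_interval_lt_1[OF j(3)] j(4)] by blast
  \<comment> \<open>Uniqueness comes from the flow: any value related by \<open>rho_rel\<close> is
    the geodesic of a vector of \<open>X_set\<close> over the first return point, and
    \<open>proj_T\<close> is injective on \<open>X_set\<close>.\<close>
  have "rho ?\<gamma> = \<gamma>'" unfolding rho_def
  proof (rule the_equality[where P = "rho_rel ?\<gamma>", OF rel])
    fix \<gamma>'' assume "rho_rel ?\<gamma> \<gamma>''"
    thus "\<gamma>'' = \<gamma>'" using *[OF rel] * inj_onD[OF inj_on_proj_T] by (metis option.inject)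
  qed
  thus ?thesis using *[OF rel] by simp
qed

lemma lost_if_E_set:
  assumes j: "\<bar>j\<bar> = 1" "y \<in> back_interval" and E: "x \<in> E_set"
  shows "lost (crossing j x y)"
proof -
  have y: "- sqrt 3 \<le> y" "y < 2 - sqrt 3" "y < 1" using j(2) back_interval_lt_1 by (auto simp: back_interval_def)
  obtain k :: int where k: "k \<ge> 2" "x = of_int k / (of_int k - 1) \<or> x = (2 * of_int k + 1) / (2 * of_int k - 1) \<or> x = of_int k"
    using E unfolding E_set_def by blast
  define n where "n = nat k"
  have n: "k = int n" "n \<ge> 2" using k(1) by (simp_all add: n_def)
  from k(2)[unfolded n(1)] show ?thesis
  proof (elim disjE)
    assume "x = of_int (int n) / (of_int (int n) - 1)"
    thus ?thesis using lost_even_cusp[OF j(1) n(2) _ y(1,3), of x] n(2) by simp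
  next
    assume "x = (2 * of_int (int n) + 1) / (2 * of_int (int n) - 1)"
    thus ?thesis using lost_odd_cusp[OF j(1) _ _ y(1,3), of n x] n(2) by simp
  next
    assume "x = of_int (int n)"
    thus ?thesis using lost_integer[OF j(1) n(2) y(2)] by simp
  qed
qed

lemma phi_proj_T: "v \<in> X_set \<Longrightarrow> phi (proj_T v) = geodesic_of_vec v"
  by (simp add: phi_def the_inv_into_f_f[OF inj_on_proj_T])

theorem theorem3p5:
  shows "(\<forall>v\<in>X_set. phi (proj_T v) = geodesic_of_vec v)
       \<and> bij_betw phi (proj_T ` X_set) A_set
       \<and> phi ` (proj_T ` X_star) = A_star
       \<and> rho ` A_star \<subseteq> A_set
       \<and> (\<forall>u \<in> proj_T ` X_star. \<exists>w \<in> proj_T ` X_set.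
             first_return u = Some w \<and> phi w = rho (phi u))
       \<and> (\<forall>u \<in> proj_T ` X_set.
             \<bar>fwd_real (phi u)\<bar> \<in> E_set \<longleftrightarrow>
             escapes_to_cusp u \<and> (\<forall>t>0. flow_M t u \<notin> proj_T ` X_set))"
proof -
  have img: "geodesic_of_vec ` X_set = A_set" 
  proof (intro equalityI subsetI)
    fix \<gamma> assume "\<gamma> \<in> A_set"
    thus "\<gamma> \<in> geodesic_of_vec ` X_set"
      using crossing_in_X_set unfolding A_set_iff by (elim exE conjE) simp
  next
    fix \<gamma> assume "\<gamma> \<in> geodesic_of_vec ` X_set"
    then obtain v where "v \<in> X_set" "\<gamma> = geodesic_of_vec v" by blast
    thus "\<gamma> \<in> A_set" unfolding A_set_iff X_set_iff by blast
  qed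
  have inj: "inj_on geodesic_of_vec X_set"
  proof (rule inj_onI)
    fix v w assume "v \<in> X_set" "w \<in> X_set" and eq: "geodesic_of_vec v = geodesic_of_vec w"
    then obtain j x y j' x' y' where *: "\<bar>j\<bar> = 1" "1 < x" "y \<in> back_interval" "v = crossing j x y"
       "\<bar>j'\<bar> = 1" "1 < x'" "y' \<in> back_interval" "w = crossing j' x' y'"
      unfolding X_set_iff by blast
    thus "v = w"
      using crossing_ends_inject[OF *(1,2) back_interval_lt_1[OF *(3)] *(5,6) back_interval_lt_1[OF *(7)]] eq by simp
  qed
  have phi_img: "phi ` proj_T ` S = geodesic_of_vec ` S" if "S \<subseteq> X_set" for S
    using that by (force simp: image_image phi_proj_T)
  have star: "X_star \<subseteq> X_set" by (auto simp: X_star_def)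
  have A_star: "geodesic_of_vec ` X_star = A_star"
    unfolding X_star_def A_star_def img[symmetric] by auto
  have step: "\<exists>w\<in>X_set. first_return (proj_T v) = Some (proj_T w) \<and> rho (geodesic_of_vec v) = geodesic_of_vec w"
    if v: "v \<in> X_star" for v
  proof -
    obtain j x y where *: "\<bar>j\<bar> = 1" "1 < x" "y \<in> back_interval" "v = crossing j x y"
      using v star X_set_iff by blast
    have "x \<notin> E_set" using v fwd_real_crossing(1)[OF *(1,2) back_interval_lt_1[OF *(3)]] by (simp add: X_star_def *(4))
    thus ?thesis using rho_eq_first_return *  by blast
  qed
  have "bij_betw phi (proj_T ` X_set) A_set"
    unfolding bij_betw_def phi_img[OF subset_refl] img
    using inj by (auto simp: inj_on_def phi_proj_T)
  moreover have "phi ` (proj_T ` X_star) = A_star"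
    unfolding phi_img[OF star] A_star ..
  moreover have "rho ` A_star \<subseteq> A_set"
    unfolding A_star[symmetric] img[symmetric] using step by fastforce
  moreover have "\<forall>u \<in> proj_T ` X_star. \<exists>w \<in> proj_T ` X_set. first_return u = Some w \<and> phi w = rho (phi u)"
    using step star phi_proj_T by (metis (no_types, lifting) imageE image_eqI subsetD)
  moreover have lost_iff: "\<bar>fwd_real (phi (proj_T v))\<bar> \<in> E_set \<longleftrightarrow>
      escapes_to_cusp (proj_T v) \<and> (\<forall>t>0. flow_M t (proj_T v) \<notin> proj_T ` X_set)"
    if v: "v \<in> X_set" for v
  proof -
    obtain j x y where *: "\<bar>j\<bar> = 1" "1 < x" "y \<in> back_interval" "v = crossing j x y"
      using v X_set_iff by blast
    have x: "\<bar>fwd_real (phi (proj_T v))\<bar> = x"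
      using fwd_real_crossing(1)[OF *(1,2) back_interval_lt_1[OF *(3)]] v by (simp add: phi_proj_T *(4))
    have T1: "v \<in> T1H" using crossing_in_T1H[OF *(1,2) back_interval_lt_1[OF *(3)]] *(4) by simp
    show ?thesis unfolding x
    proof
      assume "x \<in> E_set"
      hence "lost v" using lost_if_E_set[OF *(1,3)] *(4) by simp
      thus "escapes_to_cusp (proj_T v) \<and> (\<forall>t>0. flow_M t (proj_T v) \<notin> proj_T ` X_set)"
        by (simp add: lost_def flow_M_proj_T[OF T1])
    next
      assume no: "escapes_to_cusp (proj_T v) \<and> (\<forall>t>0. flow_M t (proj_T v) \<notin> proj_T ` X_set)"
      show "x \<in> E_set"
      proof (rule ccontr)
        assume "x \<notin> E_set"
        hence "v \<in> X_star" using x v by (simp add: X_star_def phi_proj_T)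
        \<comment> \<open>Off \<open>E_set\<close> a first return exists, so the section would be
          met at a positive time.\<close>
        then obtain w where "first_return (proj_T v) = Some w" using step by blast
        hence "\<exists>t. is_first_return_time (proj_T v) t"
          by (auto simp: first_return_def split: if_splits)
        thus False using no by (auto simp: is_first_return_time_def)
      qed
    qed
  qed
  have "\<forall>u \<in> proj_T ` X_set. \<bar>fwd_real (phi u)\<bar> \<in> E_set \<longleftrightarrow>
      escapes_to_cusp u \<and> (\<forall>t>0. flow_M t u \<notin> proj_T ` X_set)"
  proof (intro ballI)
    fix u assume "u \<in> proj_T ` X_set"
    then obtain v where "v \<in> X_set" "u = proj_T v" by blast
    thus "\<bar>fwd_real (phi u)\<bar> \<in> E_set \<longleftrightarrow>
        escapes_to_cusp u \<and> (\<forall>t>0. flow_M t u \<notin> proj_T ` X_set)"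
      using lost_iff by simp
  qed
  ultimately show ?thesis using phi_proj_T by simp
qed

end
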